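(* Let $(p_n)_{n\in\mathbb{N}}$ be a sequence of positive integers with $p_n\to\infty$ as $n\to\infty$. For any fixed $s,t\in(0,1]$ the sequence $$\Big(\frac{p_n}{n}\Big)^{1/3}\big(H_n(s,t)-\mathbb{E}[H_n(s,t)]\big)$$ converges mod-Gaussian on any strip $S_{(a,b)}$ ($-\infty<a<b<\infty$) with speed $$t_n=\Big(\frac{p_n}{n}\Big)^{2/3}\kappa_2(H_n(s,t))\ \sim\ n^{1/3}p_n^{2/3}\,\frac{s^2}{2}\int_0^t\Big(\frac{t-x}{1-x}\Big)^2dx\ \to\ \infty$$ and limiting function $$\psi(z)=\exp\Big(-z^3\,\frac{s^2}{6}\int_0^t\Big(\frac{t-x}{1-x}\Big)^3dx\Big).$$
   Context: For each $n$, let $p_{2n+1,i,j}$ ($1\le i\le 2n$, $0\le j\le p_n-1$) and $r_{2n+1,i,j}$ ($1\le i\le 2n$, $1\le j\le p_n-1$) be independent random variables with $$p_{2n+1,i,j}\sim\beta\Big(\tfrac{p_n+1}{2}(2n-i+2)-\tfrac j2,\ \tfrac{p_n+1}{2}(2n-i+2)\Big),\qquad r_{2n+1,i,j}\sim\beta\Big(\tfrac{p_n+1}{2}(2n-i+2)-\tfrac j2,\ \tfrac j2\Big),$$ where $\beta(\cdot,\cdot)$ is the Beta distribution on $[0,1]$. For $s,t\in[0,1]$ define $$\begin{aligned}H_n(s,t)=\sum_{i=1}^{\lfloor nt\rfloor}\Big\{&\sum_{j=1}^{\lfloor p_ns\rfloor-1}\Big(\log\big(r_{2n+1,2i,j}^{\lfloor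 nt\rfloor-i}\big)+\log\big(r_{2n+1,2i-1,j}^{\lfloor nt\rfloor-i+1}\big)\Big)\\&+\sum_{j=0}^{\lfloor p_ns\rfloor-1}\log\big(p_{2n+1,2i,j}^{\lfloor nt\rfloor-i+1}(1-p_{2n+1,2i,j})^{\lfloor nt\rfloor-i}\big)\\&+\sum_{j=0}^{\lfloor p_ns\rfloor-1}\log\big(p_{2n+1,2i-1,j}^{\lfloor nt\rfloor-i+1}(1-p_{2n+1,2i-1,j})^{\lfloor nt\rfloor-i+1}\big)\Big\},\end{aligned}$$ with empty sums equal to $0$ and $H_n(0,t)=0$. $\kappa_m(X)$ denotes the $m$-th cumulant of $X$ (so $\kappa_2$ is the variance). $S_{(a,b)}=\{z\in\mathbb{C}\mid a<\Re(z)<b\}$. Definition of mod-$\phi$ convergence (formulated for $a<0<b$): let $\phi$ be a non-constant infinitely divisible distribution with moment generating function $\exp(\eta(z))$, let $(t_n)_{n\in\mathbb{N}}$ be a real sequence, and let $(X_n)_{n\in\mathbb{N}}$ be a sequence of real-valued random variables whose moment generating functions exist on $S_{(a,b)}$. If $t_n\to\infty$ and, for some non-vanishing analytic function $\psi$ on $S_{(a,b)}$, $\exp(-t_n\eta(z))\,\mathbb{E}[\exp(zX_n)]\to\psi(z)$ locally uniformly on $S_{(a,b)}$, then $(X_n)$ is said to converge mod-$\phi$ on $S_{(a,b)}$ with speed $(t_n)$ (and limiting function $\psi$). Mod-Gaussian convergence is the case where $\phi$ is the standard normal distribution, $\eta(z)=z^2/2$. $a_n\sim b_n$ means $a_n/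b_n\to1$.
   Formalization: On each strip S_(a,b), mod-Gaussian convergence is asserted for the sequence from some index n0(a,b) on, because for small n the moment generating function need not exist on a wide strip (e.g. n=1, p_1=1, s=t=1, a<-2); speed asymptotics hold for the full sequence. *)

theory Defs
  imports "HOL-Probability.Probability" "HOL-Library.Landau_Symbols"
begin

definition beta_density :: "real \<Rightarrow> real \<Rightarrow> real \<Rightarrow> real" where
  "beta_density a b x = x powr (a - 1) * (1 - x) powr (b - 1) / Beta a b * indicator {0<..<1} x"

definition beta_distributed :: "'a measure \<Rightarrow> ('a \<Rightarrow> real) \<Rightarrow> real \<Rightarrow> real \<Rightarrow> bool" where
  "beta_distributed M X a b \<longleftrightarrow> distributed M lborel X (\<lambda>x. ennreal (beta_density a b x))"

text \<open>The cumulants are the derivatives at 0 of the cumulant generating function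
  \<open>log E[exp(uX)]\<close> (\<open>u\<close> real). As usual they are meaningful for an \<open>X\<close> whose moment
  generating function is finite in a neighbourhood of 0.\<close>

definition cumulant :: "'a measure \<Rightarrow> nat \<Rightarrow> ('a \<Rightarrow> real) \<Rightarrow> real" where
  "cumulant M m X = (deriv ^^ m) (\<lambda>u::real. ln (\<integral>\<omega>. exp (u * X \<omega>) \<partial>M)) 0"

definition strip :: "real \<Rightarrow> real \<Rightarrow> complex set" where
  "strip a b = {z. a < Re z \<and> Re z < b}"

definition mgf :: "'a measure \<Rightarrow> ('a \<Rightarrow> real) \<Rightarrow> complex \<Rightarrow> complex" where
  "mgf M X z = (\<integral>\<omega>. exp (z * complex_of_real (X \<omega>)) \<partial>M)"

definition mgf_exists_on :: "'a measure \<Rightarrow> ('a \<Rightarrow> real) \<Rightarrow> complex set \<Rightarrow> bool" where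
  "mgf_exists_on M X S \<longleftrightarrow> (\<forall>z\<in>S. integrable M (\<lambda>\<omega>. exp (z * complex_of_real (X \<omega>))))"

text \<open>For every \<open>n\<close>, \<open>\<phi>\<close> is the law of a sum of \<open>n\<close> i.i.d. random variables.\<close>

definition infinitely_divisible :: "real measure \<Rightarrow> bool" where
  "infinitely_divisible \<phi> \<longleftrightarrow> real_distribution \<phi> \<and>
     (\<forall>n::nat. n \<ge> 1 \<longrightarrow> (\<exists>\<nu>. real_distribution \<nu> \<and>
        \<phi> = distr (\<Pi>\<^sub>M k\<in>{..<n}. \<nu>) borel (\<lambda>x. \<Sum>k<n. x k)))"

text \<open>The random variables \<open>X n\<close> may live on different probability spaces \<open>M n\<close>;
  \<open>exp \<circ> \<eta>\<close> is the moment generating function of \<open>\<phi>\<close>, \<open>\<tau>\<close> is the speed and \<open>\<psi>\<close> is the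
  limiting function.\<close>

definition mod_phi_convergent ::
  "real measure \<Rightarrow> (complex \<Rightarrow> complex) \<Rightarrow> real \<Rightarrow> real \<Rightarrow> (nat \<Rightarrow> 'a measure) \<Rightarrow>
   (nat \<Rightarrow> 'a \<Rightarrow> real) \<Rightarrow> (nat \<Rightarrow> real) \<Rightarrow> (complex \<Rightarrow> complex) \<Rightarrow> bool" where
  "mod_phi_convergent \<phi> \<eta> a b M X \<tau> \<psi> \<longleftrightarrow>
     infinitely_divisible \<phi> \<and> (\<nexists>c. \<phi> = return borel c) \<and>
     mgf_exists_on \<phi> (\<lambda>x. x) (strip a b) \<and>
     (\<forall>z\<in>strip a b. mgf \<phi> (\<lambda>x. x) z = exp (\<eta> z)) \<and>
     (\<forall>n. prob_space (M n) \<and> X n \<in> borel_measurable (M n) \<and> mgf_exists_on (M n) (X n) (strip a b)) \<and>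
     filterlim \<tau> at_top sequentially \<and>
     \<psi> analytic_on strip a b \<and> (\<forall>z\<in>strip a b. \<psi> z \<noteq> 0) \<and>
     (\<forall>z\<in>strip a b. \<exists>d>0. cball z d \<subseteq> strip a b \<and>
        uniform_limit (cball z d) (\<lambda>n w. exp (- complex_of_real (\<tau> n) * \<eta> w) * mgf (M n) (X n) w)
          \<psi> sequentially)"

definition mod_gaussian_convergent ::
  "real \<Rightarrow> real \<Rightarrow> (nat \<Rightarrow> 'a measure) \<Rightarrow> (nat \<Rightarrow> 'a \<Rightarrow> real) \<Rightarrow> (nat \<Rightarrow> real) \<Rightarrow>
   (complex \<Rightarrow> complex) \<Rightarrow> bool" where
  "mod_gaussian_convergent a b M X \<tau> \<psi> \<longleftrightarrow>
     mod_phi_convergent std_normal_distribution (\<lambda>z. z\<^sup>2 / 2) a b M X \<tau> \<psi>"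

text \<open>\<open>P n i j\<close> and \<open>R n i j\<close> stand for \<open>p_{2n+1,i,j}\<close> and \<open>r_{2n+1,i,j}\<close>, and \<open>p n\<close> for \<open>p_n\<close>.
  The disjoint sum of index sets makes the \<open>P\<close>'s and \<open>R\<close>'s (for fixed \<open>n\<close>) jointly
  independent; nothing is required between different \<open>n\<close>.\<close>

definition beta_array ::
  "(nat \<Rightarrow> 'a measure) \<Rightarrow> (nat \<Rightarrow> nat) \<Rightarrow> (nat \<Rightarrow> nat \<Rightarrow> nat \<Rightarrow> 'a \<Rightarrow> real) \<Rightarrow>
   (nat \<Rightarrow> nat \<Rightarrow> nat \<Rightarrow> 'a \<Rightarrow> real) \<Rightarrow> bool" where
  "beta_array M p P R \<longleftrightarrow> (\<forall>n. prob_space (M n) \<and>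
     (\<forall>i\<in>{1..2*n}. \<forall>j\<in>{0..p n - 1}. beta_distributed (M n) (P n i j)
        ((real (p n) + 1) / 2 * (2 * real n - real i + 2) - real j / 2)
        ((real (p n) + 1) / 2 * (2 * real n - real i + 2))) \<and>
     (\<forall>i\<in>{1..2*n}. \<forall>j\<in>{1..p n - 1}. beta_distributed (M n) (R n i j)
        ((real (p n) + 1) / 2 * (2 * real n - real i + 2) - real j / 2)
        (real j / 2)) \<and>
     prob_space.indep_vars (M n) (\<lambda>_. borel)
       (case_sum (\<lambda>(i, j). P n i j) (\<lambda>(i, j). R n i j))
       (({1..2*n} \<times> {0..p n - 1}) <+> ({1..2*n} \<times> {1..p n - 1})))"

definition Hproc ::
  "(nat \<Rightarrow> nat) \<Rightarrow> (nat \<Rightarrow> nat \<Rightarrow> nat \<Rightarrow> 'a \<Rightarrow> real) \<Rightarrow> (nat \<Rightarrow> nat \<Rightarrow> nat \<Rightarrow> 'a \<Rightarrow> real) \<Rightarrow>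
   real \<Rightarrow> real \<Rightarrow> nat \<Rightarrow> 'a \<Rightarrow> real" where
  "Hproc p P R s t n \<omega> =
     (let N = nat \<lfloor>real n * t\<rfloor>; K = nat \<lfloor>real (p n) * s\<rfloor> in
      \<Sum>i\<in>{1..N}.
        (\<Sum>j\<in>{1..<K}. ln (R n (2*i) j \<omega> ^ (N - i)) + ln (R n (2*i - 1) j \<omega> ^ (N - i + 1))) +
        (\<Sum>j\<in>{0..<K}. ln (P n (2*i) j \<omega> ^ (N - i + 1) * (1 - P n (2*i) j \<omega>) ^ (N - i))) +
        (\<Sum>j\<in>{0..<K}. ln (P n (2*i - 1) j \<omega> ^ (N - i + 1) * (1 - P n (2*i - 1) j \<omega>) ^ (N - i + 1))))"

end

(* The logarithm of the moment generating function of the n-th process is an explicit sum L(u) of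
   differences of ln Gamma, by independence and Euler's Beta integral; the identity holds for real u
   first and for complex u by analytic continuation. Write q = p_n + 1. A Beta(A, B) variable with
   exponents a, b contributes
     a^2 psi'(A + a u) + b^2 psi'(B + b u) - (a + b)^2 psi'(A + B + (a + b) u)
   to L''(u), and replacing psi'(z) by 1/z turns this into
     (a B - b A)^2 / (z1 z2 (z1 + z2)),   z1 = A + a u,  z2 = B + b u.
   For the p-variables this is negligible, for the r-variables it is c^2 (j/2) / z^2 up to a
   negligible error, where c is the exponent. Hence L'' is, uniformly on the disc |u| <= q/4, a simple
   rational sum up to o(n). The values of this sum and of its derivative at 0 are Riemann sums for the
   two integrals, and Cauchy's inequality transfers this derivative to the third derivative of L and
   bounds the fourth by O(n / q^2), so that the Taylor remainder of L at (p_n/n)^(1/3) z tends to 0. *)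

theory Submission
  imports Defs "HOL-Complex_Analysis.Complex_Analysis" "HOL-Real_Asymp.Real_Asymp"
begin

subsection \<open>Cumulant generating function of a logarithmic Beta variable\<close>

text \<open>The row sizes decide that the errors are o(n). Row i has at most q entries of each kind,
  each with error O(1/(q \<alpha>_i) + 1/q^2), where \<alpha>_i = \<open>row_scale n i\<close> is at
  least 1 but can fall to order 1 in the last rows. The total is O(sum of 1/\<alpha>_i) + O(n/q),
  and the first sum is harmonic. The p-variables are small because their two parameters, and their
  two exponents, nearly agree, so that a B - b A almost cancels. The r-variables have b = 0; this
  also removes psi' at the parameter j/2, which may be too small for 1/z to be a good substitute.
  The radius q/4 is dictated by the exponents: they are at most \<alpha>_i, and the large parameters
  are at least q \<alpha>_i / 2, so real parts stay above q \<alpha>_i / 4. Cauchy's inequality on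
  this disc gains 1/q per derivative and replaces estimates of higher polygamma functions. With
  \<epsilon> = (p_n/n)^(1/3) the cubic term has order \<epsilon>^3 n / q, which is bounded, and the
  quartic one \<epsilon>^4 n / q^2 is at most n^(-1/3). The linear and quadratic terms need no limit
  here: centring and speed cancel them exactly.\<close>

lemma not_nonpos_Reals_if_Re_pos: "Re z > 0 \<Longrightarrow> z \<notin> \<real>\<^sub>\<le>\<^sub>0"
  by (auto simp: complex_nonpos_Reals_iff)

lemma not_nonpos_Ints_if_Re_pos: "Re z > 0 \<Longrightarrow> z \<notin> \<int>\<^sub>\<le>\<^sub>0"
  using not_nonpos_Reals_if_Re_pos nonpos_Ints_subset_nonpos_Reals by blast

text \<open>The series of 1/(z+k)^2 is compared with 1/z, written as the telescoping series of
  1/(z+k) - 1/(z+k+1). The k-th terms differ by 1/((z+k)^2 (z+k+1)). With x = Re z and y = x + k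
  this has norm at most 1/(x y (y+1)), which is 1/x times the k-th term of the telescoping series
  for 1/x.\<close>

lemma Trigamma_approx:
  fixes z :: complex
  assumes "Re z > 0"
  shows "norm (Polygamma 1 z - 1 / z) \<le> 1 / (Re z)\<^sup>2"
proof -
  define x where "x = Re z"
  have x: "x > 0" using assms by (simp add: x_def)
  have z0: "z \<noteq> 0" using assms by auto
  have zk: "z + of_nat k \<noteq> 0" for k
    using assms by (metis add_pos_nonneg of_nat_0_le_iff order_less_irrefl plus_complex.simps(1) complex_Re_of_nat zero_complex.simps(1))
  have "summable (\<lambda>k. inverse ((z + of_nat k)\<^sup>2))"
    using Polygamma_converges'[OF z0, of 2] by simp
  then have 1: "(\<lambda>k. inverse ((z + of_nat k)\<^sup>2)) sums Polygamma 1 z"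
    by (simp add: Polygamma_def summable_sums power2_eq_square)
  have 2: "(\<lambda>k. inverse (z + of_nat k) - inverse (z + of_nat (Suc k))) sums (inverse (z + of_nat 0) - 0)"
    by (intro telescope_sums'[OF filterlim_compose[OF tendsto_inverse_0]]
              tendsto_add_filterlim_at_infinity[OF tendsto_const] tendsto_of_nat)
  have 3: "(\<lambda>k. inverse (x + of_nat k) - inverse (x + of_nat (Suc k))) sums (inverse (x + of_nat 0) - 0)"
    by (intro telescope_sums'[OF filterlim_compose[OF tendsto_inverse_0]]
              tendsto_add_filterlim_at_infinity[OF tendsto_const] tendsto_of_nat)
  have 4: "norm (inverse ((z + of_nat k)\<^sup>2) - (inverse (z + of_nat k) - inverse (z + of_nat (Suc k))))
     \<le> 1 / x * (inverse (x + of_nat k) - inverse (x + of_nat (Suc k)))" for k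
  proof -
    define w where "w = z + of_nat k"
    define y where "y = x + of_nat k"
    have y: "y > 0" "y \<ge> x" using x by (auto simp: y_def)
    have w0: "w \<noteq> 0" "w + 1 \<noteq> 0" using zk[of k] zk[of "Suc k"] by (auto simp: w_def add_ac)
    have nw: "norm w \<ge> y" "norm (w + 1) \<ge> y + 1"
      using complex_Re_le_cmod[of w] complex_Re_le_cmod[of "w+1"] by (auto simp: w_def y_def x_def)
    have "inverse (w\<^sup>2) - (inverse w - inverse (w + 1)) = 1 / (w\<^sup>2 * (w + 1))"
      using w0 by (simp add: divide_simps power2_eq_square)
    then have "norm (inverse (w\<^sup>2) - (inverse w - inverse (w + 1))) = 1 / ((norm w)\<^sup>2 * norm (w + 1))"
      by (simp add: norm_divide norm_mult norm_power)
    also have "\<dots> \<le> 1 / ((x * y) * (y + 1))"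
    proof (intro divide_left_mono mult_mono)
      show "x * y \<le> (norm w)\<^sup>2" unfolding power2_eq_square
        using y nw x by (intro mult_mono) auto
    qed (use y nw x w0 in auto)
    also have "\<dots> = 1 / x * (inverse y - inverse (y + 1))"
      using y x by (simp add: field_simps)
    finally show ?thesis by (simp add: w_def y_def add_ac)
  qed
  have 5: "(\<lambda>k. inverse ((z + of_nat k)\<^sup>2) - (inverse (z + of_nat k) - inverse (z + of_nat (Suc k))))
     sums (Polygamma 1 z - 1 / z)"
    using sums_diff[OF 1 2] by (simp add: inverse_eq_divide)
  have 6: "(\<lambda>k. 1 / x * (inverse (x + of_nat k) - inverse (x + of_nat (Suc k)))) sums (1 / x * (1 / x))"
    using sums_mult[OF 3, of "1/x"] by (simp add: inverse_eq_divide)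
  have "norm (Polygamma 1 z - 1 / z) \<le> 1 / x * (1 / x)"
    using norm_suminf_le[OF 4 sums_summable[OF 6]] sums_unique[OF 5] sums_unique[OF 6] by simp
  then show ?thesis by (simp add: x_def power2_eq_square)
qed

text \<open>For X with law Beta(\<alpha>, \<beta>) this is log E[X^(a u) (1-X)^(b u)], the logarithm
  of a quotient of Beta functions. Since \<open>ln_Gamma\<close> is holomorphic off the nonpositive
  reals, this form fixes the branch and no complex logarithm of a product is taken. The primed
  versions are the first two derivatives in \<open>u\<close>.\<close>

definition beta_cgf :: "real \<Rightarrow> real \<Rightarrow> real \<Rightarrow> real \<Rightarrow> complex \<Rightarrow> complex" where
  "beta_cgf \<alpha> \<beta> a b u =
     ln_Gamma (of_real \<alpha> + of_real a * u) + ln_Gamma (of_real \<beta> + of_real b * u)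
     - ln_Gamma (of_real (\<alpha> + \<beta>) + of_real (a + b) * u)
     - (ln_Gamma (of_real \<alpha>) + ln_Gamma (of_real \<beta>) - ln_Gamma (of_real (\<alpha> + \<beta>)))"

definition beta_cgf' :: "real \<Rightarrow> real \<Rightarrow> real \<Rightarrow> real \<Rightarrow> complex \<Rightarrow> complex" where
  "beta_cgf' \<alpha> \<beta> a b u =
     of_real a * Digamma (of_real \<alpha> + of_real a * u) + of_real b * Digamma (of_real \<beta> + of_real b * u)
     - of_real (a + b) * Digamma (of_real (\<alpha> + \<beta>) + of_real (a + b) * u)"

definition beta_cgf'' :: "real \<Rightarrow> real \<Rightarrow> real \<Rightarrow> real \<Rightarrow> complex \<Rightarrow> complex" where
  "beta_cgf'' \<alpha> \<beta> a b u =
     of_real (a\<^sup>2) * Polygamma 1 (of_real \<alpha> + of_real a * u)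
     + of_real (b\<^sup>2) * Polygamma 1 (of_real \<beta> + of_real b * u)
     - of_real ((a + b)\<^sup>2) * Polygamma 1 (of_real (\<alpha> + \<beta>) + of_real (a + b) * u)"

lemma
  assumes "Re (of_real \<alpha> + of_real a * u) > 0" "Re (of_real \<beta> + of_real b * u) > 0"
  shows has_field_derivative_beta_cgf: "(beta_cgf \<alpha> \<beta> a b has_field_derivative beta_cgf' \<alpha> \<beta> a b u) (at u)"
    and has_field_derivative_beta_cgf': "(beta_cgf' \<alpha> \<beta> a b has_field_derivative beta_cgf'' \<alpha> \<beta> a b u) (at u)"
proof -
  have pos: "Re (of_real (\<alpha> + \<beta>) + of_real (a + b) * u) > 0"
    using assms by (simp add: algebra_simps)
  note [simp] = not_nonpos_Reals_if_Re_pos[OF assms(1)] not_nonpos_Reals_if_Re_pos[OF assms(2)]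
    not_nonpos_Reals_if_Re_pos[OF pos] not_nonpos_Ints_if_Re_pos[OF assms(1)]
    not_nonpos_Ints_if_Re_pos[OF assms(2)] not_nonpos_Ints_if_Re_pos[OF pos]
  show "(beta_cgf \<alpha> \<beta> a b has_field_derivative beta_cgf' \<alpha> \<beta> a b u) (at u)"
    unfolding beta_cgf_def beta_cgf'_def
    by (rule derivative_eq_intros refl | simp del: of_real_add)+
  show "(beta_cgf' \<alpha> \<beta> a b has_field_derivative beta_cgf'' \<alpha> \<beta> a b u) (at u)"
    unfolding beta_cgf'_def beta_cgf''_def
    by (rule derivative_eq_intros refl | simp add: power2_eq_square del: of_real_add)+
qed

lemma beta_cgf_0 [simp]: "beta_cgf \<alpha> \<beta> a b 0 = 0"
  by (simp add: beta_cgf_def)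

lemma beta_cgf''_approx:
  fixes u :: complex and \<alpha> \<beta> a b :: real
  defines "z1 \<equiv> of_real \<alpha> + of_real a * u" and "z2 \<equiv> of_real \<beta> + of_real b * u"
  assumes "Re z1 > 0" "Re z2 > 0"
  shows "norm (beta_cgf'' \<alpha> \<beta> a b u - of_real ((a * \<beta> - b * \<alpha>)\<^sup>2) / (z1 * z2 * (z1 + z2)))
     \<le> a\<^sup>2 / (Re z1)\<^sup>2 + b\<^sup>2 / (Re z2)\<^sup>2 + (a + b)\<^sup>2 / (Re (z1 + z2))\<^sup>2"
proof -
  have z3: "of_real (\<alpha> + \<beta>) + of_real (a + b) * u = z1 + z2"
    by (simp add: z1_def z2_def algebra_simps)
  have pos: "Re (z1 + z2) > 0" using assms by simp
  have nz: "z1 \<noteq> 0" "z2 \<noteq> 0" "z1 + z2 \<noteq> 0" using assms(3,4) pos by (auto simp del: plus_complex.simps)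
  have ident: "of_real ((a * \<beta> - b * \<alpha>)\<^sup>2) / (z1 * z2 * (z1 + z2)) =
     of_real (a\<^sup>2) * (1 / z1) + of_real (b\<^sup>2) * (1 / z2) - of_real ((a + b)\<^sup>2) * (1 / (z1 + z2))"
  proof -
    \<comment> \<open>The terms in \<open>u\<close> cancel, so the numerator of the rational form is
      a real constant although \<open>z1\<close> and \<open>z2\<close> vary.\<close>
    have "complex_of_real (a * \<beta> - b * \<alpha>) = of_real a * z2 - of_real b * z1"
      by (simp add: z1_def z2_def algebra_simps)
    then have "of_real ((a * \<beta> - b * \<alpha>)\<^sup>2) = (of_real a * z2 - of_real b * z1)\<^sup>2"
      by (metis of_real_power)
    moreover have "(of_real a * z2 - of_real b * z1)\<^sup>2 / (z1 * z2 * (z1 + z2)) =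
        (of_real a)\<^sup>2 / z1 + (of_real b)\<^sup>2 / z2 - (of_real a + of_real b)\<^sup>2 / (z1 + z2)"
      using nz by (simp add: divide_simps) algebra
    ultimately show ?thesis by simp
  qed
  define e where "e z = Polygamma 1 z - 1 / z" for z :: complex
  have "beta_cgf'' \<alpha> \<beta> a b u - of_real ((a * \<beta> - b * \<alpha>)\<^sup>2) / (z1 * z2 * (z1 + z2)) =
     of_real (a\<^sup>2) * e z1 + of_real (b\<^sup>2) * e z2 - of_real ((a + b)\<^sup>2) * e (z1 + z2)"
    unfolding beta_cgf''_def ident z3 e_def z1_def[symmetric] z2_def[symmetric]
    by (simp only: right_diff_distrib) (simp add: algebra_simps)
  also have "norm \<dots> \<le> norm (of_real (a\<^sup>2) * e z1) + norm (of_real (b\<^sup>2) * e z2) + norm (of_real ((a + b)\<^sup>2) * e (z1 + z2))"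
    by (intro order_trans[OF norm_triangle_ineq4] add_mono norm_triangle_ineq order_refl)
  also have "\<dots> \<le> a\<^sup>2 * (1 / (Re z1)\<^sup>2) + b\<^sup>2 * (1 / (Re z2)\<^sup>2) + (a + b)\<^sup>2 * (1 / (Re (z1 + z2))\<^sup>2)"
    unfolding norm_mult norm_of_real abs_power2 e_def
    using assms(3,4) pos by (intro add_mono mult_left_mono Trigamma_approx) auto
  finally show ?thesis by simp
qed

text \<open>The hypothesis bounds the second derivative because that is what the trigamma estimate
  controls. Cauchy's inequality on discs of radius r/4 about points of norm at most r/2 bounds the
  second derivative of \<open>f''\<close> by 2 B / (r/4)^2 = 32 B / r^2. The Taylor remainder
  divides this by 3!, and 32/6 is below 6.\<close>

lemma Taylor3_bound:
  fixes f f' f'' :: "complex \<Rightarrow> complex"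
  assumes r: "r > 0"
    and f: "\<And>u. u \<in> ball 0 r \<Longrightarrow> (f has_field_derivative f' u) (at u)"
    and f': "\<And>u. u \<in> ball 0 r \<Longrightarrow> (f' has_field_derivative f'' u) (at u)"
    and B: "\<And>u. u \<in> ball 0 r \<Longrightarrow> norm (f'' u) \<le> B"
    and w: "norm w \<le> r / 2"
  shows "norm (f w - (f 0 + f' 0 * w + f'' 0 * w\<^sup>2 / 2 + deriv f'' 0 * w ^ 3 / 6)) \<le> 6 * B * norm w ^ 4 / r\<^sup>2"
proof -
  have B0: "B \<ge> 0" using order_trans[OF norm_ge_zero B[of 0]] r by simp
  have "f' holomorphic_on ball 0 r"
    unfolding holomorphic_on_open[OF open_ball] using f' by blast
  then have "deriv f' holomorphic_on ball 0 r" by (rule holomorphic_deriv) auto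
  then have hol2: "f'' holomorphic_on ball 0 r"
    by (rule holomorphic_transform) (use f' DERIV_imp_deriv in blast)
  \<comment> \<open>The given \<open>f\<close> and \<open>f'\<close> are the first two entries, so
    that the Taylor coefficients come out as \<open>f' 0\<close> and \<open>f'' 0\<close>; iterated
    \<open>deriv\<close> starts only at \<open>f''\<close>.\<close>
  define F where "F i = (if i = 0 then f else if i = 1 then f' else (deriv ^^ (i - 2)) f'')" for i :: nat
  have F: "(F i has_field_derivative F (Suc i) x) (at x within cball 0 (r/2))" if "x \<in> cball 0 (r/2)" "i \<le> 3" for i x
  proof -
    have x: "x \<in> ball 0 r" using that r by auto
    have "(F i has_field_derivative F (Suc i) x) (at x)"
    proof (cases "i < 2")
      case True
      then have "i = 0 \<or> i = 1" by auto
      then show ?thesis using f[OF x] f'[OF x] by (auto simp: F_def)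
    next
      case False
      then obtain k where k: "i = Suc (Suc k)" by (metis add_2_eq_Suc le_iff_add not_less)
      have "(deriv ^^ k) f'' holomorphic_on ball 0 r"
        by (rule holomorphic_higher_deriv[OF hol2]) auto
      then have "((deriv ^^ k) f'' has_field_derivative deriv ((deriv ^^ k) f'') x) (at x)"
        using x by (intro holomorphic_derivI) auto
      then show ?thesis using k by (simp add: F_def numeral_2_eq_2)
    qed
    then show ?thesis by (rule has_field_derivative_at_within)
  qed
  have B4: "norm (F (Suc 3) x) \<le> 32 * B / r\<^sup>2" if "x \<in> cball 0 (r/2)" for x
  proof -
    have sub: "cball x (r/4) \<subseteq> ball 0 r"
    proof
      fix y assume "y \<in> cball x (r/4)"
      then have "norm y \<le> norm x + r / 4"
        using norm_triangle_ineq2[of y x] by (simp add: dist_norm norm_minus_commute)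
      then show "y \<in> ball 0 r" using that r by simp
    qed
    then have sub': "ball x (r/4) \<subseteq> ball 0 r" using ball_subset_cball by blast
    have "norm ((deriv ^^ 2) f'' x) \<le> fact 2 * B / (r/4)^2"
    proof (rule Cauchy_inequality)
      show "f'' holomorphic_on ball x (r/4)" using hol2 sub' by (rule holomorphic_on_subset)
      show "continuous_on (cball x (r/4)) f''"
        using hol2 sub by (meson holomorphic_on_imp_continuous_on continuous_on_subset)
      show "norm (f'' y) \<le> B" if "norm (x - y) = r/4" for y
        by (intro B subsetD[OF sub]) (use that in \<open>auto simp: dist_norm\<close>)
    qed (use r in auto)
    then show ?thesis by (simp add: F_def field_simps power2_eq_square)
  qed
  have "norm (F 0 w - (\<Sum>i\<le>3. F i 0 * (w - 0) ^ i / fact i)) \<le> 32 * B / r\<^sup>2 * norm (w - 0) ^ Suc 3 / fact 3"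
    by (rule complex_Taylor[of "cball 0 (r/2)"]) (use F B4 w r in auto)
  also have "(\<Sum>i\<le>3. F i 0 * (w - 0) ^ i / fact i) = f 0 + f' 0 * w + f'' 0 * w\<^sup>2 / 2 + deriv f'' 0 * w ^ 3 / 6"
    by (simp add: F_def numeral_3_eq_3 numeral_2_eq_2)
  also have "32 * B / r\<^sup>2 * norm (w - 0) ^ Suc 3 / fact 3 \<le> 6 * B * norm w ^ 4 / r\<^sup>2"
    using B0 r by (simp add: fact_numeral divide_simps mult_nonneg_nonneg mult_right_mono numeral_eq_Suc)
  finally show ?thesis by (simp add: F_def)
qed

subsection \<open>Moment generating functions\<close>

lemma Beta_real_pos: "a > 0 \<Longrightarrow> b > 0 \<Longrightarrow> Beta a b > (0 :: real)"
  by (simp add: Beta_def)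

lemma
  assumes "\<alpha> > 0" "\<beta> > 0" "\<alpha> + x > 0" "\<beta> + y > 0"
  shows integrable_beta_density_moment: "integrable lborel (\<lambda>t. beta_density \<alpha> \<beta> t * (t powr x * (1 - t) powr y))"
    and integral_beta_density_moment: "(\<integral>t. beta_density \<alpha> \<beta> t * (t powr x * (1 - t) powr y) \<partial>lborel) = Beta (\<alpha> + x) (\<beta> + y) / Beta \<alpha> \<beta>"
proof -
  let ?g = "\<lambda>t. t powr (\<alpha> + x - 1) * (1 - t) powr (\<beta> + y - 1) :: real"
  \<comment> \<open>The open interval of the density and the closed one of the Beta integral differ
    only at the end points, where \<open>0 powr _ = 0\<close> makes the integrand vanish.\<close>
  have eq: "(\<lambda>t. beta_density \<alpha> \<beta> t * (t powr x * (1 - t) powr y)) =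
     (\<lambda>t. (indicator {0..1} t *\<^sub>R ?g t) / Beta \<alpha> \<beta>)"
    by (auto simp: fun_eq_iff beta_density_def indicator_def powr_add [symmetric] algebra_simps)
  have int: "set_integrable lborel {0..1} ?g"
    by (rule integrable_Beta) (use assms in auto)
  show "integrable lborel (\<lambda>t. beta_density \<alpha> \<beta> t * (t powr x * (1 - t) powr y))"
    unfolding eq using int by (simp add: set_integrable_def)
  show "(\<integral>t. beta_density \<alpha> \<beta> t * (t powr x * (1 - t) powr y) \<partial>lborel) = Beta (\<alpha> + x) (\<beta> + y) / Beta \<alpha> \<beta>"
    unfolding eq using set_borel_integral_eq_integral(2)[OF int]
      integral_unique[OF has_integral_Beta_real[OF assms(3,4)]]
    by (simp add: set_lebesgue_integral_def add_diff_eq)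
qed

lemma exp_beta_cgf_of_real:
  assumes "\<alpha> > 0" "\<beta> > 0" "\<alpha> + a * x > 0" "\<beta> + b * x > 0"
  shows "exp (beta_cgf \<alpha> \<beta> a b (of_real x)) = of_real (Beta (\<alpha> + a * x) (\<beta> + b * x) / Beta \<alpha> \<beta>)"
proof -
  have ln_G: "ln_Gamma (of_real c + of_real d * of_real x) = complex_of_real (ln_Gamma (c + d * x))"
    if "c + d * x > 0" for c d
    using ln_Gamma_complex_of_real[OF that] by simp
  have pos: "(\<alpha> + \<beta>) + (a + b) * x > 0"
    using assms by (simp add: algebra_simps)
  have "beta_cgf \<alpha> \<beta> a b (of_real x) =
      of_real (ln_Gamma (\<alpha> + a * x) + ln_Gamma (\<beta> + b * x) - ln_Gamma ((\<alpha> + \<beta>) + (a + b) * x)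
         - (ln_Gamma \<alpha> + ln_Gamma \<beta> - ln_Gamma (\<alpha> + \<beta>)))"
    unfolding beta_cgf_def ln_G[OF assms(3)] ln_G[OF assms(4)] ln_G[OF pos]
    using assms ln_Gamma_complex_of_real[of \<alpha>] ln_Gamma_complex_of_real[of \<beta>] ln_Gamma_complex_of_real[of "\<alpha> + \<beta>"]
    by (simp del: of_real_add add: of_real_diff) (simp add: of_real_add)
  also have "exp \<dots> = of_real (Gamma (\<alpha> + a * x) * Gamma (\<beta> + b * x) / Gamma ((\<alpha> + \<beta>) + (a + b) * x)
         / (Gamma \<alpha> * Gamma \<beta> / Gamma (\<alpha> + \<beta>)))"
    using assms pos by (simp only: exp_of_real exp_add exp_diff Gamma_real_pos_exp[symmetric] add_pos_pos)
  finally show ?thesis by (simp add: Beta_def algebra_simps)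
qed

text \<open>Knowing \<open>exp (beta_cgf ...)\<close> determines the exponent only up to multiples
  of 2 pi i. Reality on the real axis is what identifies it with the real \<open>ln\<close> in the
  definition of \<open>cumulant\<close>.\<close>

lemma beta_cgf_of_real_in_Reals:
  assumes "\<alpha> > 0" "\<beta> > 0" "\<alpha> + a * x > 0" "\<beta> + b * x > 0"
  shows "beta_cgf \<alpha> \<beta> a b (of_real x) \<in> \<real>"
proof -
  have ln_G: "ln_Gamma (of_real c + of_real d * of_real x) \<in> (\<real> :: complex set)"
    if "c + d * x > 0" for c d
    using ln_Gamma_complex_of_real[OF that] by (metis Reals_of_real of_real_add of_real_mult)
  have ln_G0: "ln_Gamma (of_real c) \<in> (\<real> :: complex set)" if "c > 0" for c
    using ln_Gamma_complex_of_real[OF that] by (metis Reals_of_real)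
  have pos: "(\<alpha> + \<beta>) + (a + b) * x > 0"
    using assms by (simp add: algebra_simps)
  show ?thesis unfolding beta_cgf_def
    using assms pos by (intro Reals_add Reals_diff ln_G ln_G0) auto
qed

lemma
  fixes X :: "'a \<Rightarrow> real" and k l :: nat
  assumes X: "beta_distributed M X \<alpha> \<beta>"
    and pos: "\<alpha> > 0" "\<beta> > 0" "\<alpha> + real k * x > 0" "\<beta> + real l * x > 0"
  shows integrable_exp_ln_beta: "integrable M (\<lambda>\<omega>. exp (x * ln (X \<omega> ^ k * (1 - X \<omega>) ^ l)))"
    and integral_exp_ln_beta: "complex_of_real (\<integral>\<omega>. exp (x * ln (X \<omega> ^ k * (1 - X \<omega>) ^ l)) \<partial>M) =
       exp (beta_cgf \<alpha> \<beta> k l (of_real x))"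
proof -
  let ?g = "\<lambda>t::real. exp (x * ln (t ^ k * (1 - t) ^ l))"
  have D: "distributed M lborel X (\<lambda>t. ennreal (beta_density \<alpha> \<beta> t))"
    using X by (simp add: beta_distributed_def)
  have nn: "0 \<le> beta_density \<alpha> \<beta> t" for t
    using Beta_real_pos[OF pos(1,2)] by (simp add: beta_density_def)
  have eq: "(\<lambda>t. beta_density \<alpha> \<beta> t * ?g t) =
      (\<lambda>t. beta_density \<alpha> \<beta> t * (t powr (real k * x) * (1 - t) powr (real l * x)))"
  proof
    fix t :: real
    show "beta_density \<alpha> \<beta> t * ?g t = beta_density \<alpha> \<beta> t * (t powr (real k * x) * (1 - t) powr (real l * x))"
    proof (cases "0 < t \<and> t < 1")
      case True
      then have "x * ln (t ^ k * (1 - t) ^ l) = real k * x * ln t + real l * x * ln (1 - t)"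
        by (simp add: ln_mult ln_realpow algebra_simps)
      then show ?thesis using True by (simp add: powr_def exp_add)
    qed (auto simp: beta_density_def)
  qed
  have "integrable lborel (\<lambda>t. beta_density \<alpha> \<beta> t * ?g t)"
    unfolding eq by (rule integrable_beta_density_moment[OF pos])
  then show "integrable M (\<lambda>\<omega>. ?g (X \<omega>))"
    by (subst (asm) distributed_integrable[OF D]) (auto simp: nn)
  have "(\<integral>\<omega>. ?g (X \<omega>) \<partial>M) = (\<integral>t. beta_density \<alpha> \<beta> t * ?g t \<partial>lborel)"
    by (rule distributed_integral[OF D, symmetric]) (auto simp: nn)
  also have "\<dots> = Beta (\<alpha> + real k * x) (\<beta> + real l * x) / Beta \<alpha> \<beta>"
    unfolding eq by (rule integral_beta_density_moment[OF pos])
  finally show "complex_of_real (\<integral>\<omega>. ?g (X \<omega>) \<partial>M) = exp (beta_cgf \<alpha> \<beta> k l (of_real x))"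
    by (simp add: exp_beta_cgf_of_real[OF pos])
qed

text \<open>The moment generating function is expanded into the power series of the moments.\<close>

lemma (in prob_space)
  fixes X :: "'a \<Rightarrow> real"
  assumes X [measurable]: "X \<in> borel_measurable M"
    and r: "r > 0"
    and int: "\<And>x. \<bar>x\<bar> < r \<Longrightarrow> integrable M (\<lambda>\<omega>. exp (x * X \<omega>))"
  shows mgf_holomorphic: "mgf M X holomorphic_on ball 0 r"
    and deriv_mgf_0: "(mgf M X has_field_derivative of_real (expectation X)) (at 0)"
proof -
  \<comment> \<open>The bound exp(x |X|) <= exp(x X) + exp(-x X) turns two-sided exponential
    integrability into one dominating function for all partial sums of the series of exp(z X) with
    |z| = x.\<close>
  have int_abs: "integrable M (\<lambda>\<omega>. exp (x * \<bar>X \<omega>\<bar>))" if "0 \<le> x" "x < r" for x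
  proof (rule Bochner_Integration.integrable_bound)
    show "integrable M (\<lambda>\<omega>. exp (x * X \<omega>) + exp ((-x) * X \<omega>))"
      using that by (intro Bochner_Integration.integrable_add int) auto
    show "AE \<omega> in M. norm (exp (x * \<bar>X \<omega>\<bar>)) \<le> norm (exp (x * X \<omega>) + exp ((-x) * X \<omega>))"
    proof (intro AE_I2)
      fix \<omega>
      show "norm (exp (x * \<bar>X \<omega>\<bar>)) \<le> norm (exp (x * X \<omega>) + exp ((-x) * X \<omega>))"
        using abs_of_pos[OF add_pos_pos[OF exp_gt_zero[of "x * X \<omega>"] exp_gt_zero[of "-(x * X \<omega>)"]]]
        by (cases "X \<omega> < 0") simp_all
    qed
  qed simp
  have pow_int: "integrable M (\<lambda>\<omega>. (x * \<bar>X \<omega>\<bar>) ^ n / fact n)" if "0 \<le> x" "x < r" for x n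
  proof (rule Bochner_Integration.integrable_bound[OF int_abs[OF that]])
    show "AE \<omega> in M. norm ((x * \<bar>X \<omega>\<bar>) ^ n / fact n) \<le> norm (exp (x * \<bar>X \<omega>\<bar>))"
    proof (intro AE_I2)
      fix \<omega>
      \<comment> \<open>One term of a nonnegative series is at most its sum; the singleton sum gives
        it the shape of a partial sum.\<close>
      have "(\<Sum>i\<in>{n}. (x * \<bar>X \<omega>\<bar>) ^ i /\<^sub>R fact i) \<le> exp (x * \<bar>X \<omega>\<bar>)"
        unfolding exp_def by (intro sum_le_suminf summable_exp_generic) (use that in auto)
      then show "norm ((x * \<bar>X \<omega>\<bar>) ^ n / fact n) \<le> norm (exp (x * \<bar>X \<omega>\<bar>))"
        using that by (simp add: divide_inverse mult.commute)
    qed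
  qed simp
  define c where "c n = complex_of_real (expectation (\<lambda>\<omega>. X \<omega> ^ n) / fact n)" for n
  have sums: "(\<lambda>n. c n * (z - 0) ^ n) sums mgf M X z" if z: "z \<in> ball 0 r" for z
  proof -
    let ?f = "\<lambda>n \<omega>. (z * of_real (X \<omega>)) ^ n / fact n"
    have nz: "0 \<le> norm z" "norm z < r" using z by auto
    have nf: "norm (?f n \<omega>) = (norm z * \<bar>X \<omega>\<bar>) ^ n / fact n" for n \<omega>
      by (simp add: norm_divide norm_mult norm_power power_mult_distrib)
    have fint: "integrable M (?f n)" for n
      by (rule Bochner_Integration.integrable_bound[OF pow_int[OF nz, of n]]) (auto simp: nf)
    have "(\<lambda>n. \<integral>\<omega>. ?f n \<omega> \<partial>M) sums (\<integral>\<omega>. (\<Sum>n. ?f n \<omega>) \<partial>M)"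
    proof (rule sums_integral[OF fint])
      show "AE \<omega> in M. summable (\<lambda>n. norm (?f n \<omega>))"
        using summable_exp_generic[of "norm z * \<bar>X _\<bar>"]
        by (intro AE_I2) (simp only: nf, simp add: divide_inverse mult.commute)
      show "summable (\<lambda>n. \<integral>\<omega>. norm (?f n \<omega>) \<partial>M)"
      proof (rule summableI_nonneg_bounded)
        fix n
        have "(\<Sum>i<n. \<integral>\<omega>. norm (?f i \<omega>) \<partial>M) = (\<integral>\<omega>. (\<Sum>i<n. norm (?f i \<omega>)) \<partial>M)"
          using fint by (intro Bochner_Integration.integral_sum[symmetric]) auto
        also have "\<dots> \<le> (\<integral>\<omega>. exp (norm z * \<bar>X \<omega>\<bar>) \<partial>M)"
        proof (rule integral_mono)
          show "integrable M (\<lambda>\<omega>. \<Sum>i<n. norm (?f i \<omega>))" using fint by auto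
          show "integrable M (\<lambda>\<omega>. exp (norm z * \<bar>X \<omega>\<bar>))" by (rule int_abs[OF nz])
          fix \<omega>
          have "(\<Sum>i<n. (norm z * \<bar>X \<omega>\<bar>) ^ i /\<^sub>R fact i) \<le> exp (norm z * \<bar>X \<omega>\<bar>)"
            unfolding exp_def by (intro sum_le_suminf summable_exp_generic) auto
          then show "(\<Sum>i<n. norm (?f i \<omega>)) \<le> exp (norm z * \<bar>X \<omega>\<bar>)"
            unfolding nf by (simp add: divide_inverse mult.commute)
        qed
        finally show "(\<Sum>i<n. \<integral>\<omega>. norm (?f i \<omega>) \<partial>M) \<le> (\<integral>\<omega>. exp (norm z * \<bar>X \<omega>\<bar>) \<partial>M)" .
      qed (auto intro: integral_nonneg_AE)
    qed
    moreover have "(\<Sum>n. ?f n \<omega>) = exp (z * of_real (X \<omega>))" for \<omega>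
      by (simp add: exp_def scaleR_conv_of_real divide_inverse mult.commute)
    moreover have "(\<integral>\<omega>. ?f n \<omega> \<partial>M) = c n * (z - 0) ^ n" for n
    proof -
      have "(\<integral>\<omega>. ?f n \<omega> \<partial>M) = (\<integral>\<omega>. (z ^ n / fact n) * of_real (X \<omega> ^ n) \<partial>M)"
        by (simp add: power_mult_distrib)
      also have "\<dots> = (z ^ n / fact n) * of_real (expectation (\<lambda>\<omega>. X \<omega> ^ n))"
        by (subst integral_mult_right_zero) (simp only: integral_complex_of_real)
      finally show ?thesis by (simp add: c_def)
    qed
    ultimately show ?thesis by (simp add: mgf_def)
  qed
  show hol: "mgf M X holomorphic_on ball 0 r"
    by (rule power_series_holomorphic[OF sums])
  \<comment> \<open>The series converges at r/2, so it may be differentiated termwise at 0, where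
    only the coefficient \<open>c 1\<close>, the mean, survives.\<close>
  have "((\<lambda>z. \<Sum>n. c n * z ^ n) has_field_derivative (\<Sum>n. diffs c n * 0 ^ n)) (at 0)"
    using sums_summable[OF sums[of "of_real (r / 2)"]] r
    by (intro termdiffs_strong[of _ "of_real (r / 2)"]) auto
  moreover have "(\<Sum>n. diffs c n * 0 ^ n) = of_real (expectation X)"
    by (simp add: powser_zero diffs_def c_def)
  moreover have "\<forall>\<^sub>F z in nhds 0. mgf M X z = (\<Sum>n. c n * z ^ n)"
    using eventually_nhds_ball[OF r, of 0]
    by eventually_elim (use sums_unique[OF sums] in simp)
  ultimately show "(mgf M X has_field_derivative of_real (expectation X)) (at 0)"
    by (subst DERIV_cong_ev[OF refl _ refl]) auto
qed

lemma has_real_derivative_Re_of_real: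
  assumes "(f has_field_derivative f') (at (complex_of_real x))"
  shows "((\<lambda>x. Re (f (of_real x))) has_real_derivative Re f') (at x)"
proof -
  have "((\<lambda>x. f (of_real x)) has_vector_derivative f') (at x)"
    using assms by (rule has_vector_derivative_real_field)
  then have "((\<lambda>x. Re (f (of_real x))) has_vector_derivative Re f') (at x)"
    by (rule bounded_linear.has_vector_derivative[OF bounded_linear_Re])
  then show ?thesis by (simp add: has_real_derivative_iff_has_vector_derivative)
qed

text \<open>The five claims share one function \<open>L\<close>, the sum of the individual cumulant
  generating functions. Independence enters only for real arguments, where the factors are positive
  real variables. Mean and variance are then read off from the first two derivatives of
  \<open>L\<close> at 0 instead of being computed from the Beta laws.\<close>

lemma (in prob_space)
  fixes Y :: "'i \<Rightarrow> 'a \<Rightarrow> real" and \<alpha> \<beta> :: "'i \<Rightarrow> real" and k l :: "'i \<Rightarrow> nat"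
  defines "H \<equiv> \<lambda>J \<omega>. \<Sum>i\<in>J. ln (Y i \<omega> ^ k i * (1 - Y i \<omega>) ^ l i)"
  assumes J: "finite J" and indep: "indep_vars (\<lambda>_. borel) Y J"
    and beta: "\<And>i. i \<in> J \<Longrightarrow> beta_distributed M (Y i) (\<alpha> i) (\<beta> i)"
    and r: "r > 0"
    and pos: "\<And>i u. i \<in> J \<Longrightarrow> norm u < r \<Longrightarrow> 0 < Re (of_real (\<alpha> i) + of_real (k i) * u)"
      "\<And>i u. i \<in> J \<Longrightarrow> norm u < r \<Longrightarrow> 0 < Re (of_real (\<beta> i) + of_real (l i) * u)"
  shows measurable_sum_ln_beta: "H J \<in> borel_measurable M"
    and integrable_exp_sum_ln_beta: "\<And>x. \<bar>x\<bar> < r \<Longrightarrow> integrable M (\<lambda>\<omega>. exp (x * H J \<omega>))"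
    and mgf_sum_ln_beta: "\<And>u. norm u < r \<Longrightarrow> mgf M (H J) u = exp (\<Sum>i\<in>J. beta_cgf (\<alpha> i) (\<beta> i) (k i) (l i) u)"
    and expectation_sum_ln_beta: "of_real (expectation (H J)) = (\<Sum>i\<in>J. beta_cgf' (\<alpha> i) (\<beta> i) (k i) (l i) 0)"
    and cumulant_sum_ln_beta: "of_real (cumulant M 2 (H J)) = (\<Sum>i\<in>J. beta_cgf'' (\<alpha> i) (\<beta> i) (k i) (l i) 0)"
proof -
  have rv [measurable]: "Y i \<in> borel_measurable M" if "i \<in> J" for i
    using beta[OF that] unfolding beta_distributed_def by (auto dest: distributed_measurable)
  show meas [measurable]: "H J \<in> borel_measurable M"
    unfolding H_def by measurable
  have pos0: "\<alpha> i > 0" "\<beta> i > 0" if "i \<in> J" for i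
    using pos(1)[OF that, of 0] pos(2)[OF that, of 0] r by auto
  have posr: "\<alpha> i + real (k i) * x > 0" "\<beta> i + real (l i) * x > 0" if "i \<in> J" "\<bar>x\<bar> < r" for i x
    using pos(1)[OF that(1), of "of_real x"] pos(2)[OF that(1), of "of_real x"] that by auto
  define L where "L = (\<lambda>u. \<Sum>i\<in>J. beta_cgf (\<alpha> i) (\<beta> i) (k i) (l i) u)"
  define L' where "L' = (\<lambda>u. \<Sum>i\<in>J. beta_cgf' (\<alpha> i) (\<beta> i) (k i) (l i) u)"
  define L'' where "L'' = (\<lambda>u. \<Sum>i\<in>J. beta_cgf'' (\<alpha> i) (\<beta> i) (k i) (l i) u)"
  have dL: "(L has_field_derivative L' u) (at u)" "(L' has_field_derivative L'' u) (at u)" if "norm u < r" for u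
    unfolding L_def L'_def L''_def
    by (intro DERIV_sum has_field_derivative_beta_cgf has_field_derivative_beta_cgf' pos that; assumption)+
  have exp_H: "exp (x * H J \<omega>) = (\<Prod>i\<in>J. exp (x * ln (Y i \<omega> ^ k i * (1 - Y i \<omega>) ^ l i)))" for x \<omega>
    unfolding H_def by (simp add: sum_distrib_left exp_sum J)
  have ind: "indep_vars (\<lambda>_. borel) (\<lambda>i \<omega>. exp (x * ln (Y i \<omega> ^ k i * (1 - Y i \<omega>) ^ l i))) J" for x
    by (rule indep_vars_compose2[OF indep]) simp
  have fac: "integrable M (\<lambda>\<omega>. exp (x * ln (Y i \<omega> ^ k i * (1 - Y i \<omega>) ^ l i)))" if "\<bar>x\<bar> < r" "i \<in> J" for x i
    by (rule integrable_exp_ln_beta[OF beta pos0 posr]) (use that in auto)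
  show intH: "integrable M (\<lambda>\<omega>. exp (x * H J \<omega>))" if "\<bar>x\<bar> < r" for x
    unfolding exp_H by (rule indep_vars_integrable[OF J ind fac[OF that]])
  have mgf_real: "complex_of_real (expectation (\<lambda>\<omega>. exp (x * H J \<omega>))) = exp (L (of_real x))" if "\<bar>x\<bar> < r" for x
  proof -
    have "complex_of_real (expectation (\<lambda>\<omega>. exp (x * H J \<omega>))) =
       (\<Prod>i\<in>J. of_real (expectation (\<lambda>\<omega>. exp (x * ln (Y i \<omega> ^ k i * (1 - Y i \<omega>) ^ l i)))))"
      unfolding exp_H by (subst indep_vars_lebesgue_integral[OF J ind fac[OF that]]) simp_all
    also have "\<dots> = (\<Prod>i\<in>J. exp (beta_cgf (\<alpha> i) (\<beta> i) (k i) (l i) (of_real x)))"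
      using that by (intro prod.cong integral_exp_ln_beta beta pos0 posr) auto
    also have "\<dots> = exp (L (of_real x))"
      by (simp add: L_def exp_sum J)
    finally show ?thesis .
  qed
  have hol: "mgf M (H J) holomorphic_on ball 0 r" by (rule mgf_holomorphic[OF meas r intH])
  have holL: "(\<lambda>u. exp (L u)) holomorphic_on ball 0 r"
  proof (intro holomorphic_intros)
    show "L holomorphic_on ball 0 r"
      unfolding holomorphic_on_open[OF open_ball] using dL(1) by (metis mem_ball_0)
  qed
  show mgf: "mgf M (H J) u = exp (L u)" if "norm u < r" for u
  proof -
    have "mgf M (H J) u - exp (L u) = 0"
    proof (rule analytic_continuation[of "\<lambda>u. mgf M (H J) u - exp (L u)" "ball 0 r" "of_real ` {-r<..<r}" 0])
      show "(\<lambda>u. mgf M (H J) u - exp (L u)) holomorphic_on ball 0 r"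
        by (intro holomorphic_intros hol holL)
      show "complex_of_real ` {-r<..<r} \<subseteq> ball 0 r" by auto
      show "0 islimpt complex_of_real ` {-r<..<r}"
        unfolding islimpt_approachable
      proof (intro allI impI)
        fix e :: real assume "e > 0"
        then show "\<exists>z\<in>complex_of_real ` {-r<..<r}. z \<noteq> 0 \<and> dist z 0 < e"
          using r by (intro bexI[of _ "of_real (min (r/2) (e/2))"] conjI imageI)
            (auto simp: dist_norm min_def simp flip: of_real_divide)
      qed
      fix z :: complex assume "z \<in> of_real ` {-r<..<r}"
      then obtain x where x: "z = of_real x" "\<bar>x\<bar> < r" by auto
      have "mgf M (H J) z = complex_of_real (expectation (\<lambda>\<omega>. exp (x * H J \<omega>)))"
        unfolding mgf_def x integral_complex_of_real[symmetric] by (simp flip: exp_of_real)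
      then show "mgf M (H J) z - exp (L z) = 0" using mgf_real[OF x(2)] x(1) by simp
    qed (use that r in auto)
    then show ?thesis by simp
  qed
  have "(mgf M (H J) has_field_derivative exp (L 0) * L' 0) (at 0)"
  proof -
    have "((\<lambda>u. exp (L u)) has_field_derivative exp (L 0) * L' 0) (at 0)"
      using DERIV_chain2[OF DERIV_exp dL(1)[of 0]] r by simp
    moreover have "\<forall>\<^sub>F u in nhds 0. mgf M (H J) u = exp (L u)"
      using eventually_nhds_ball[OF r, of 0] by eventually_elim (auto intro: mgf)
    ultimately show ?thesis by (subst DERIV_cong_ev[OF refl _ refl])
  qed
  then show "of_real (expectation (H J)) = L' 0"
    using DERIV_unique[OF deriv_mgf_0[OF meas r intH]] by (simp add: L_def)
  have K: "ln (expectation (\<lambda>\<omega>. exp (x * H J \<omega>))) = Re (L (of_real x))" if "\<bar>x\<bar> < r" for x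
  proof -
    have "L (of_real x) \<in> \<real>"
      unfolding L_def using that by (intro sum_in_Reals beta_cgf_of_real_in_Reals pos0 posr)
    then obtain y where y: "L (of_real x) = of_real y" by (auto elim: Reals_cases)
    then have "expectation (\<lambda>\<omega>. exp (x * H J \<omega>)) = exp y"
      using mgf_real[OF that] by (simp only: exp_of_real of_real_eq_iff)
    then show ?thesis by (simp add: y)
  qed
  have near: "\<forall>\<^sub>F x in nhds (y::real). \<bar>x\<bar> < r" if "\<bar>y\<bar> < r" for y
    using that by (intro order_tendstoD(2)[of abs "\<bar>y\<bar>"] tendsto_intros filterlim_ident)
  \<comment> \<open>\<open>cumulant\<close> iterates \<open>deriv\<close>, so the first derivative
    must be known on a whole neighbourhood of 0 before it can be differentiated again.\<close>
  have dK: "deriv (\<lambda>x. ln (expectation (\<lambda>\<omega>. exp (x * H J \<omega>)))) x = Re (L' (of_real x))" if "\<bar>x\<bar> < r" for x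
  proof -
    have "deriv (\<lambda>x. ln (expectation (\<lambda>\<omega>. exp (x * H J \<omega>)))) x = deriv (\<lambda>x. Re (L (of_real x))) x"
      using near[OF that] by (intro deriv_cong_ev refl) (auto elim!: eventually_mono intro: K)
    also have "\<dots> = Re (L' (of_real x))"
      using that by (intro DERIV_imp_deriv has_real_derivative_Re_of_real dL) auto
    finally show ?thesis .
  qed
  have "cumulant M 2 (H J) = deriv (\<lambda>x. Re (L' (of_real x))) 0"
    unfolding cumulant_def numeral_2_eq_2 funpow.simps o_def id_apply
    using near[of 0] r by (intro deriv_cong_ev refl) (auto elim!: eventually_mono intro: dK)
  also have "\<dots> = Re (L'' (of_real 0))"
    using r by (intro DERIV_imp_deriv has_real_derivative_Re_of_real dL) auto
  finally have cum: "cumulant M 2 (H J) = Re (L'' 0)" by simp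
  have "L'' 0 \<in> \<real>" unfolding L''_def beta_cgf''_def
    using pos0 by (intro sum_in_Reals Reals_add Reals_diff Reals_mult Polygamma_Real)
      (auto simp flip: of_real_add simp: less_imp_neq[symmetric] add_pos_pos)
  then show "of_real (cumulant M 2 (H J)) = L'' 0"
    using cum by (simp add: of_real_Re)
qed

subsection \<open>The standard normal law\<close>

lemma distr_component_PiM_density:
  assumes "i \<in> I" "prob_space (density lborel f)"
  shows "distr (Pi\<^sub>M I (\<lambda>_. density lborel f)) lborel (\<lambda>x. x i) = density lborel f"
proof -
  have "distr (Pi\<^sub>M I (\<lambda>_. density lborel f)) lborel (\<lambda>x. x i)
      = distr (Pi\<^sub>M I (\<lambda>_. density lborel f)) (density lborel f) (\<lambda>x. x i)"
    by (rule distr_cong) auto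
  also have "\<dots> = density lborel f"
    by (rule distr_PiM_component) (use assms in auto)
  finally show ?thesis .
qed

text \<open>Variances of independent normal variables add, so n copies of variance 1/n give variance
  1; \<open>normal_density\<close> takes the standard deviation, hence 1 / sqrt n.\<close>

lemma std_normal_distribution_eq_distr_sum:
  assumes "n \<ge> 1"
  defines "\<nu> \<equiv> density lborel (normal_density 0 (1 / sqrt (real n)))"
  shows "std_normal_distribution = distr (\<Pi>\<^sub>M k\<in>{..<n}. \<nu>) borel (\<lambda>x. \<Sum>k<n. x k)"
proof -
  let ?Q = "\<Pi>\<^sub>M k\<in>{..<n}. \<nu>"
  have \<sigma>: "1 / sqrt (real n) > 0" using assms by simp
  have "0 \<in> {..<n}" using assms(1) by simp
  then have ne: "{..<n} \<noteq> {}" by blast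
  have \<nu>: "prob_space \<nu>"
    unfolding \<nu>_def by (rule prob_space_normal_density[OF \<sigma>])
  interpret Q: prob_space ?Q by (intro prob_space_PiM \<nu>)
  have sets_\<nu> [measurable_cong, simp]: "sets \<nu> = sets borel" by (simp add: \<nu>_def)
  have comp: "distr ?Q lborel (\<lambda>x. x k) = \<nu>" if "k < n" for k
    using distr_component_PiM_density[of k "{..<n}"] \<nu> that by (simp add: \<nu>_def)
  have comp': "distr ?Q borel (\<lambda>x. x k) = \<nu>" if "k < n" for k
    by (subst comp[OF that, symmetric]) (rule distr_cong, auto)
  \<comment> \<open>Independence means that the joint law is the product of the marginals. The joint
    law of the coordinates is \<open>?Q\<close> itself, and the marginals are all
    \<open>\<nu>\<close>.\<close>
  have "Q.indep_vars (\<lambda>_. borel) (\<lambda>k x. x k) {..<n}"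
  proof (subst Q.indep_vars_iff_distr_eq_PiM')
    have "distr ?Q (\<Pi>\<^sub>M i\<in>{..<n}. borel) (\<lambda>x. \<lambda>i\<in>{..<n}. x i) = distr ?Q ?Q (\<lambda>x. x)"
    proof (rule distr_cong)
      show "sets (\<Pi>\<^sub>M i\<in>{..<n}. borel) = sets ?Q" by (rule sets_PiM_cong) auto
      show "(\<lambda>i\<in>{..<n}. x i) = x" if "x \<in> space ?Q" for x
        using that by (auto simp: space_PiM PiE_def extensional_restrict)
    qed simp
    also have "\<dots> = ?Q" by (rule distr_id)
    also have "\<dots> = (\<Pi>\<^sub>M i\<in>{..<n}. distr ?Q borel (\<lambda>x. x i))"
      by (rule PiM_cong) (auto simp: comp')
    finally show "distr ?Q (\<Pi>\<^sub>M i\<in>{..<n}. borel) (\<lambda>x. \<lambda>i\<in>{..<n}. x i) = (\<Pi>\<^sub>M i\<in>{..<n}. distr ?Q borel (\<lambda>x. x i))" .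
  qed (use ne in auto)
  then have "distributed ?Q lborel (\<lambda>x. \<Sum>k<n. x k)
      (normal_density (\<Sum>k<n. 0) (sqrt (\<Sum>k<n. (1 / sqrt (real n))\<^sup>2)))"
  proof (rule Q.sum_indep_normal[rotated 2])
    show "distributed ?Q lborel (\<lambda>x. x k) (normal_density 0 (1 / sqrt (real n)))" if "k \<in> {..<n}" for k
      unfolding distributed_def using that by (auto simp: comp) (simp add: \<nu>_def)
  qed (use ne \<sigma> in auto)
  then have "distributed ?Q lborel (\<lambda>x. \<Sum>k<n. x k) std_normal_density"
    using assms by (simp add: power_divide)
  then have "distr ?Q lborel (\<lambda>x. \<Sum>k<n. x k) = std_normal_distribution"
    by (rule distributed_distr_eq_density)
  moreover have "distr ?Q lborel (\<lambda>x. \<Sum>k<n. x k) = distr ?Q borel (\<lambda>x. \<Sum>k<n. x k)"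
    by (rule distr_cong) auto
  ultimately show ?thesis by simp
qed

lemma infinitely_divisible_std_normal: "infinitely_divisible std_normal_distribution"
  unfolding infinitely_divisible_def
proof (intro conjI allI impI exI)
  show "real_distribution std_normal_distribution" by (rule real_dist_normal_dist)
  fix n :: nat assume "n \<ge> 1"
  then show "std_normal_distribution = distr (\<Pi>\<^sub>M k\<in>{..<n}. density lborel (normal_density 0 (1 / sqrt (real n)))) borel (\<lambda>x. \<Sum>k<n. x k)"
    by (rule std_normal_distribution_eq_distr_sum)
  have "1 / sqrt (real n) > 0" using \<open>n \<ge> 1\<close> by simp
  then show "real_distribution (density lborel (normal_density 0 (1 / sqrt (real n))))"
    using prob_space_normal_density by (auto simp: real_distribution_def real_distribution_axioms_def)
qed

text \<open>Completing the square turns the real part of \<open>z\<close> into a shift of the density and leaves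
  the characteristic function at the imaginary part.\<close>

lemma
  shows integrable_exp_std_normal: "integrable std_normal_distribution (\<lambda>x. exp (z * complex_of_real x))"
    and mgf_std_normal: "mgf std_normal_distribution (\<lambda>x. x) z = exp (z\<^sup>2 / 2)"
proof -
  define a where "a = Re z"
  define b where "b = Im z"
  have z: "z = of_real a + \<i> * of_real b" by (simp add: a_def b_def complex_eq_iff)
  let ?\<phi> = std_normal_density
  let ?f = "\<lambda>x. ?\<phi> x *\<^sub>R exp (\<i> * of_real b * complex_of_real x)"
  have sq: "exp (a * (a + x)) * ?\<phi> (a + x) = exp (a\<^sup>2 / 2) * ?\<phi> x" for x
    by (simp add: std_normal_density_def exp_add [symmetric] mult_ac power2_eq_square algebra_simps)
       (simp add: field_simps flip: exp_add)
  \<comment> \<open>The form \<open>a + 1 * x\<close> is that of the affine substitution rule for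
    \<open>lborel\<close>, applied below with slope 1.\<close>
  have shift: "?\<phi> (a + 1 * x) *\<^sub>R exp (z * complex_of_real (a + 1 * x)) =
      exp (a\<^sup>2 / 2 + \<i> * b * a) * ?f x" for x
  proof -
    have "exp (z * complex_of_real (a + 1 * x)) =
        of_real (exp (a * (a + x))) * (exp (\<i> * b * a) * exp (\<i> * of_real b * complex_of_real x))"
      by (simp add: z exp_of_real [symmetric] flip: exp_add) (simp add: algebra_simps)
    then have "?\<phi> (a + 1 * x) *\<^sub>R exp (z * complex_of_real (a + 1 * x)) =
        of_real (exp (a * (a + x)) * ?\<phi> (a + x)) * (exp (\<i> * b * a) * exp (\<i> * of_real b * complex_of_real x))"
      by (simp add: scaleR_conv_of_real mult_ac)
    moreover have "exp ((complex_of_real a)\<^sup>2 / 2) = of_real (exp (a\<^sup>2 / 2))"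
      by (simp flip: exp_of_real)
    ultimately show ?thesis unfolding sq
      by (simp add: scaleR_conv_of_real exp_add mult_ac)
  qed
  have intf: "integrable lborel ?f"
    by (rule Bochner_Integration.integrable_bound[OF integrable_normal_density[of 1 0]])
       (auto simp: normal_density_nonneg norm_mult)
  have int: "integrable lborel (\<lambda>x. ?\<phi> x *\<^sub>R exp (z * complex_of_real x))"
    by (rule iffD1[OF lborel_integrable_real_affine_iff[of 1 _ a]])
       (simp, unfold shift, intro integrable_mult_right intf)
  then show "integrable std_normal_distribution (\<lambda>x. exp (z * complex_of_real x))"
    by (subst integrable_density) (auto simp: normal_density_nonneg)
  have "mgf std_normal_distribution (\<lambda>x. x) z = (\<integral>x. ?\<phi> x *\<^sub>R exp (z * complex_of_real x) \<partial>lborel)"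
    unfolding mgf_def by (subst integral_density) (auto simp: normal_density_nonneg)
  also have "\<dots> = (\<integral>x. exp (a\<^sup>2 / 2 + \<i> * b * a) * ?f x \<partial>lborel)"
    by (subst lborel_integral_real_affine[of 1 _ a]) (simp_all only: shift, simp_all)
  also have "\<dots> = exp (a\<^sup>2 / 2 + \<i> * b * a) * (\<integral>x. ?f x \<partial>lborel)"
    by (rule integral_mult_right_zero)
  also have "(\<integral>x. ?f x \<partial>lborel) = char std_normal_distribution b"
    unfolding char_def
    by (subst integral_density) (auto simp: normal_density_nonneg mult_ac)
  also have "\<dots> = exp (- (complex_of_real b)\<^sup>2 / 2)"
    by (simp add: char_std_normal_distribution exp_of_real [symmetric])
  also have "exp (a\<^sup>2 / 2 + \<i> * b * a) * exp (- (complex_of_real b)\<^sup>2 / 2) = exp (z\<^sup>2 / 2)"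
    unfolding z by (simp add: power2_eq_square algebra_simps add_divide_distrib diff_divide_distrib flip: exp_add)
  finally show "mgf std_normal_distribution (\<lambda>x. x) z = exp (z\<^sup>2 / 2)" .
qed

text \<open>A point mass at c has moment generating function exp(y c). Equality with exp(y^2/2)
  would force c = 1/2 at y = 1 and c = 1 at y = 2.\<close>

lemma std_normal_distribution_neq_return: "std_normal_distribution \<noteq> return borel c"
proof
  assume eq: "std_normal_distribution = return borel c"
  have "mgf (return borel c) (\<lambda>x. x) (of_real y) = of_real (exp (y * c))" for y
    unfolding mgf_def by (subst integral_return) (auto simp flip: exp_of_real)
  then have "complex_of_real (exp (y * c)) = of_real (exp (y\<^sup>2 / 2))" for y
    using mgf_std_normal[of "of_real y"] by (simp add: eq flip: exp_of_real)
  then have "y * c = y\<^sup>2 / 2" for y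
    by (metis exp_inj_iff of_real_eq_iff)
  from this[of 1] this[of 2] show False by simp
qed

subsection \<open>Asymptotics of the second derivative\<close>

text \<open>This is where the disc of radius q/4 enters: an exponent c of at most \<alpha> moves a
  parameter of size q \<alpha> by at most a quarter of it.\<close>

lemma Re_scaled_ge:
  assumes "0 \<le> c" "c \<le> \<alpha>" "0 \<le> q" "norm u \<le> q / 4"
  shows "Re (of_real c * u) \<ge> - (q * \<alpha> / 4)"
proof -
  have "\<bar>Re (of_real c * u)\<bar> \<le> c * norm u"
    using abs_Re_le_cmod[of "of_real c * u"] assms by (simp add: norm_mult)
  also have "\<dots> \<le> \<alpha> * (q / 4)" using assms by (intro mult_mono) auto
  finally show ?thesis by (simp add: mult_ac)
qed

text \<open>This is the case of the p-variables, with h = j/2. With A = q \<alpha> the numerator is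
  the square of (a - c) A + c h, which is at most 2 A in modulus because |a - c| <= 1 and c h <=
  \<alpha> q. The denominator has order A^3, so the rational term is O(1/A): 4 A^2 divided by A^3/32
  gives 128/A.\<close>

lemma beta_cgf''_bound:
  fixes q \<alpha> a c h :: real and u :: complex
  assumes q: "q > 0" and c: "0 \<le> c" "c \<le> \<alpha>" and a: "0 \<le> a" "a \<le> \<alpha>" "\<bar>a - c\<bar> \<le> 1" and \<alpha>: "1 \<le> \<alpha>"
    and h: "0 \<le> h" "h \<le> q / 2" and u: "norm u \<le> q / 4"
  shows "norm (beta_cgf'' (q * \<alpha> - h) (q * \<alpha>) a c u) \<le> 128 / (q * \<alpha>) + 48 / q\<^sup>2"
proof -
  define A where "A = q * \<alpha>"
  define z1 where "z1 = of_real (A - h) + of_real a * u"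
  define z2 where "z2 = of_real A + of_real c * u"
  have A: "A > 0" "A \<ge> q" using q \<alpha> by (auto simp: A_def)
  have Re: "Re z1 \<ge> A / 4" "Re z2 \<ge> A / 4" "Re (z1 + z2) \<ge> A / 2"
    using Re_scaled_ge[OF a(1,2) _ u] Re_scaled_ge[OF c _ u] q h A
    by (auto simp: z1_def z2_def A_def[symmetric])
  have nrm: "norm z1 \<ge> A / 4" "norm z2 \<ge> A / 4" "norm (z1 + z2) \<ge> A / 2"
    using Re complex_Re_le_cmod[of z1] complex_Re_le_cmod[of z2] complex_Re_le_cmod[of "z1 + z2"] by linarith+
  have "a * A - c * (A - h) = (a - c) * A + c * h" by (simp add: algebra_simps)
  also have "\<bar>\<dots>\<bar> \<le> \<bar>a - c\<bar> * A + c * h"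
    using A c h by (intro order_trans[OF abs_triangle_ineq]) (simp add: abs_mult)
  also have "\<dots> \<le> 1 * A + \<alpha> * q"
    using A c h a q by (intro add_mono mult_mono) auto
  also have "\<dots> = 2 * A" by (simp add: A_def)
  finally have num: "(a * A - c * (A - h))\<^sup>2 \<le> (2 * A)\<^sup>2"
    by (metis abs_ge_zero power2_abs power_mono)
  have main: "norm (of_real ((a * A - c * (A - h))\<^sup>2) / (z1 * z2 * (z1 + z2))) \<le> 128 / A"
  proof -
    have "norm (of_real ((a * A - c * (A - h))\<^sup>2) / (z1 * z2 * (z1 + z2))) =
        (a * A - c * (A - h))\<^sup>2 / (norm z1 * norm z2 * norm (z1 + z2))"
      by (simp only: norm_divide norm_mult norm_of_real abs_power2)
    also have "\<dots> \<le> (2 * A)\<^sup>2 / (A / 4 * (A / 4) * (A / 2))"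
      using A num nrm by (intro frac_le mult_mono) auto
    also have "\<dots> = 128 / A" using A by (simp add: field_simps power2_eq_square)
    finally show ?thesis .
  qed
  \<comment> \<open>The factor \<open>m\<close> treats the three error terms alike: it is 1 for
    \<open>z1\<close> and \<open>z2\<close>, and 2 for their sum, where both the exponent and the
    lower bound double. Three times 16 is the 48 of the claim.\<close>
  have sq: "x\<^sup>2 / (Re z)\<^sup>2 \<le> 16 / q\<^sup>2" if "0 \<le> x" "x \<le> m * \<alpha>" "Re z \<ge> m * (A / 4)" "m > 0" for x m z
  proof -
    have "x\<^sup>2 / (Re z)\<^sup>2 \<le> (m * \<alpha>)\<^sup>2 / (m * (A / 4))\<^sup>2"
      using that A by (intro frac_le power_mono) auto
    also have "\<dots> = 16 / q\<^sup>2" using that q \<alpha> by (simp add: A_def power2_eq_square)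
    finally show ?thesis .
  qed
  have "Re z1 > 0" "Re z2 > 0" using Re A by auto
  from beta_cgf''_approx[of "A - h" a u A c, folded z1_def z2_def, OF this]
  have "norm (beta_cgf'' (A - h) A a c u) \<le>
      norm (of_real ((a * A - c * (A - h))\<^sup>2) / (z1 * z2 * (z1 + z2)))
      + (a\<^sup>2 / (Re z1)\<^sup>2 + c\<^sup>2 / (Re z2)\<^sup>2 + (a + c)\<^sup>2 / (Re (z1 + z2))\<^sup>2)"
    using norm_triangle_ineq2[of "beta_cgf'' (A - h) A a c u" "of_real ((a * A - c * (A - h))\<^sup>2) / (z1 * z2 * (z1 + z2))"]
    by linarith
  also have "\<dots> \<le> 128 / A + (16 / q\<^sup>2 + 16 / q\<^sup>2 + 16 / q\<^sup>2)"
    using a c Re by (intro add_mono main sq[of _ 1] sq[of _ 2]) auto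
  finally show ?thesis by (simp add: A_def)
qed

text \<open>This is the case of the r-variables, with h = j/2. Their parameters add up to A = q
  \<alpha>, so z1 + z2 is Z = A + c u, and the rational form reduces to c^2 h / (z1 Z). Replacing
  \<open>z1\<close> by \<open>Z\<close> costs c^2 h^2 / (z1 Z^2), which is at most 16/A. The
  trigamma value at h, which may be as small as 1/2, carries the coefficient 0.\<close>

lemma beta_cgf''_approx_main:
  fixes q \<alpha> c h :: real and u :: complex
  assumes q: "q > 0" and c: "0 \<le> c" "c \<le> \<alpha>" and \<alpha>: "1 \<le> \<alpha>"
    and h: "0 < h" "h \<le> q / 2" and u: "norm u \<le> q / 4"
  shows "norm (beta_cgf'' (q * \<alpha> - h) h c 0 u - of_real (c\<^sup>2 * h) / (of_real (q * \<alpha>) + of_real c * u)\<^sup>2)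
     \<le> 16 / (q * \<alpha>) + 32 / q\<^sup>2"
proof -
  define A where "A = q * \<alpha>"
  define Z where "Z = of_real A + of_real c * u"
  define z1 where "z1 = of_real (A - h) + of_real c * u"
  have A: "A > 0" "A \<ge> q" using q \<alpha> by (auto simp: A_def)
  have Z: "z1 + of_real h = Z" by (simp add: z1_def Z_def)
  have Re: "Re z1 \<ge> A / 4" "Re Z \<ge> A / 4"
    using Re_scaled_ge[OF c _ u] q h A by (auto simp: z1_def Z_def A_def[symmetric])
  have nrm: "norm z1 \<ge> A / 4" "norm Z \<ge> A / 4"
    using Re complex_Re_le_cmod[of z1] complex_Re_le_cmod[of Z] by linarith+
  have nz: "z1 \<noteq> 0" "Z \<noteq> 0" using nrm A by auto
  have main: "norm (of_real ((c * h)\<^sup>2) / (z1 * of_real h * Z) - of_real (c\<^sup>2 * h) / Z\<^sup>2) \<le> 16 / A"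
  proof -
    have "of_real ((c * h)\<^sup>2) / (z1 * of_real h * Z) - of_real (c\<^sup>2 * h) / Z\<^sup>2
        = of_real (c\<^sup>2 * h) * (Z - z1) / (z1 * Z\<^sup>2)"
      using nz h by (simp add: divide_simps power2_eq_square) (simp add: algebra_simps)
    also have "Z - z1 = of_real h" by (simp flip: Z)
    finally have "norm (of_real ((c * h)\<^sup>2) / (z1 * of_real h * Z) - of_real (c\<^sup>2 * h) / Z\<^sup>2) =
        (c\<^sup>2 * h * h) / (norm z1 * (norm Z)\<^sup>2)"
      using h by (simp add: norm_divide norm_mult norm_power)
    also have "\<dots> \<le> (\<alpha>\<^sup>2 * (q / 2) * (q / 2)) / (A / 4 * (A / 4)\<^sup>2)"
      using A nrm c h q by (intro frac_le mult_mono power_mono) auto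
    also have "\<dots> = 16 / A" using q \<alpha> by (simp add: A_def field_simps power2_eq_square)
    finally show ?thesis .
  qed
  have sq: "c\<^sup>2 / (Re z)\<^sup>2 \<le> 16 / q\<^sup>2" if "Re z \<ge> A / 4" for z
  proof -
    have "c\<^sup>2 / (Re z)\<^sup>2 \<le> \<alpha>\<^sup>2 / (A / 4)\<^sup>2"
      using that A c by (intro frac_le power_mono) auto
    also have "\<dots> = 16 / q\<^sup>2" using q \<alpha> by (simp add: A_def power2_eq_square)
    finally show ?thesis .
  qed
  have "Re z1 > 0" "Re (of_real h + of_real 0 * u) > 0" using Re A h by auto
  from beta_cgf''_approx[of "A - h" c u h 0, folded z1_def, OF this]
  have "norm (beta_cgf'' (A - h) h c 0 u - of_real ((c * h)\<^sup>2) / (z1 * of_real h * Z))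
     \<le> c\<^sup>2 / (Re z1)\<^sup>2 + c\<^sup>2 / (Re Z)\<^sup>2"
    by (simp add: Z del: of_real_power of_real_mult)
  moreover have "\<dots> \<le> 16 / q\<^sup>2 + 16 / q\<^sup>2" by (intro add_mono sq Re)
  ultimately have "norm (beta_cgf'' (A - h) h c 0 u - of_real ((c * h)\<^sup>2) / (z1 * of_real h * Z)) \<le> 32 / q\<^sup>2"
    by simp
  with main have "norm (beta_cgf'' (A - h) h c 0 u - of_real (c\<^sup>2 * h) / Z\<^sup>2) \<le> 16 / A + 32 / q\<^sup>2"
    using norm_triangle_ineq[of "beta_cgf'' (A - h) h c 0 u - of_real ((c * h)\<^sup>2) / (z1 * of_real h * Z)"
        "of_real ((c * h)\<^sup>2) / (z1 * of_real h * Z) - of_real (c\<^sup>2 * h) / Z\<^sup>2"]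
    by simp
  then show ?thesis by (simp add: A_def Z_def)
qed

text \<open>The Beta parameter \<open>(p n + 1) / 2 * (2 * n - i + 2)\<close> of row \<open>i\<close> is \<open>(p n + 1) * row_scale n i\<close>; the exponents in
  \<open>Hproc\<close> are \<open>row_wt N i\<close> for \<open>R\<close> and \<open>1 - P\<close>, and \<open>row_wt1 N i\<close> for \<open>P\<close>, for even and odd rows alike.\<close>

definition row_scale :: "nat \<Rightarrow> nat \<Rightarrow> real" where
  "row_scale n i = (2 * real n - real i + 2) / 2"

definition row_wt :: "nat \<Rightarrow> nat \<Rightarrow> nat" where
  "row_wt N i = N - i div 2"

definition row_wt1 :: "nat \<Rightarrow> nat \<Rightarrow> nat" where
  "row_wt1 N i = N + 1 - (i + 1) div 2"

text \<open>These are the conditions on exponents and scale required by the estimates for single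
  variables. The last one, that the two exponents of a p-variable differ by at most 1, is the source
  of the cancellation in \<open>beta_cgf''_bound\<close>.\<close>

lemma row_bounds:
  assumes "N \<le> n" "i \<in> {1..2*N}"
  shows "1 \<le> row_scale n i" "real (row_wt N i) \<le> row_scale n i" "real (row_wt1 N i) \<le> row_scale n i"
    "\<bar>real (row_wt1 N i) - real (row_wt N i)\<bar> \<le> 1"
proof -
  have i: "i \<le> 2 * N" "i div 2 \<le> N" "(i + 1) div 2 \<le> N + 1" "real i \<le> 2 * real n" using assms by auto
  have d: "2 * real (i div 2) \<le> real i" "2 * real (i div 2) \<ge> real i - 1"
     "2 * real ((i + 1) div 2) \<le> real i + 1" "2 * real ((i + 1) div 2) \<ge> real i" by linarith+
  have w: "real (row_wt N i) = real N - real (i div 2)" "real (row_wt1 N i) = real N + 1 - real ((i + 1) div 2)"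
    using i by (auto simp: row_wt_def row_wt1_def of_nat_diff)
  have "real N \<le> real n" using assms by simp
  then show "1 \<le> row_scale n i" "real (row_wt N i) \<le> row_scale n i" "real (row_wt1 N i) \<le> row_scale n i"
    "\<bar>real (row_wt1 N i) - real (row_wt N i)\<bar> \<le> 1"
    unfolding w row_scale_def using d i by (auto simp: field_simps)
qed

section \<open>Second derivative of the whole array and its leading sum\<close>

definition array_cgf'' :: "nat \<Rightarrow> nat \<Rightarrow> nat \<Rightarrow> real \<Rightarrow> complex \<Rightarrow> complex" where
  "array_cgf'' n N K q u = (\<Sum>i\<in>{1..2*N}.
     (\<Sum>j<K. beta_cgf'' (q * row_scale n i - real j / 2) (q * row_scale n i) (row_wt1 N i) (row_wt N i) u) +
     (\<Sum>j\<in>{1..<K}. beta_cgf'' (q * row_scale n i - real j / 2) (real j / 2) (row_wt N i) 0 u))"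

text \<open>The main term c^2 (j/2) / Z^2 of an r-variable depends on j only through j/2, so summing
  over the columns collapses it to the factor K (K - 1) / 4.\<close>

definition lead_cgf'' :: "nat \<Rightarrow> nat \<Rightarrow> nat \<Rightarrow> real \<Rightarrow> complex \<Rightarrow> complex" where
  "lead_cgf'' n N K q u = (\<Sum>i\<in>{1..2*N}. of_real (real K * (real K - 1) / 4 * (real (row_wt N i))\<^sup>2) /
     (of_real (q * row_scale n i) + of_real (row_wt N i) * u)\<^sup>2)"

lemma sum_half_lessThan: "(\<Sum>j\<in>{1..<K}. real j / 2) = real K * (real K - 1) / 4"
  by (induction K) (auto simp: atLeastLessThanSuc field_simps Suc_le_eq)

text \<open>Each row has at most q entries of either kind. The single-variable errors multiplied by
  q give (128 + 16) / \<open>row_scale n i\<close> and (48 + 32) / q.\<close>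

lemma array_cgf''_approx:
  assumes NK: "N \<le> n" "real K \<le> q" and q: "q > 0" and u: "norm u \<le> q / 4"
  shows "norm (array_cgf'' n N K q u - lead_cgf'' n N K q u) \<le> (\<Sum>i\<in>{1..2*N}. 144 / row_scale n i + 80 / q)"
proof -
  define Z where "Z i = of_real (q * row_scale n i) + of_real (row_wt N i) * u" for i
  define PP where "PP i j = beta_cgf'' (q * row_scale n i - real j / 2) (q * row_scale n i) (row_wt1 N i) (row_wt N i) u" for i j
  define RR where "RR i j = beta_cgf'' (q * row_scale n i - real j / 2) (real j / 2) (row_wt N i) 0 u" for i j
  define m where "m i j = of_real ((real (row_wt N i))\<^sup>2 * (real j / 2)) / (Z i)\<^sup>2" for i j
  have lead: "lead_cgf'' n N K q u = (\<Sum>i\<in>{1..2*N}. \<Sum>j\<in>{1..<K}. m i j)"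
    unfolding lead_cgf''_def m_def Z_def[symmetric] sum_half_lessThan[symmetric]
    by (simp add: sum_divide_distrib[symmetric] sum_distrib_left mult_ac sum_distrib_right
        flip: of_real_sum of_real_mult of_real_power)
  have "norm (array_cgf'' n N K q u - lead_cgf'' n N K q u) =
     norm (\<Sum>i\<in>{1..2*N}. (\<Sum>j<K. PP i j) + (\<Sum>j\<in>{1..<K}. RR i j - m i j))"
    unfolding array_cgf''_def lead PP_def[symmetric] RR_def[symmetric]
    by (simp add: sum_subtractf sum.distrib add_diff_eq)
  also have "\<dots> \<le> (\<Sum>i\<in>{1..2*N}. 144 / row_scale n i + 80 / q)"
  proof (rule sum_norm_le)
    fix i assume i: "i \<in> {1..2*N}"
    note rb = row_bounds[OF NK(1) i]
    have pos: "row_scale n i > 0" using rb(1) by simp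
    have "norm ((\<Sum>j<K. PP i j) + (\<Sum>j\<in>{1..<K}. RR i j - m i j)) \<le>
       (\<Sum>j<K. norm (PP i j)) + (\<Sum>j\<in>{1..<K}. norm (RR i j - m i j))"
      by (intro order_trans[OF norm_triangle_ineq] add_mono norm_sum)
    also have "\<dots> \<le> (\<Sum>j<K. 128 / (q * row_scale n i) + 48 / q\<^sup>2) + (\<Sum>j\<in>{1..<K}. 16 / (q * row_scale n i) + 32 / q\<^sup>2)"
      unfolding PP_def RR_def m_def Z_def using rb u q NK
      by (intro add_mono sum_mono beta_cgf''_bound beta_cgf''_approx_main) auto
    also have "\<dots> \<le> q * (128 / (q * row_scale n i) + 48 / q\<^sup>2) + q * (16 / (q * row_scale n i) + 32 / q\<^sup>2)"
      using pos q NK by (auto intro!: add_mono mult_right_mono)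
    also have "\<dots> = 144 / row_scale n i + 80 / q"
      using pos q by (simp add: field_simps power2_eq_square)
    finally show "norm ((\<Sum>j<K. PP i j) + (\<Sum>j\<in>{1..<K}. RR i j - m i j)) \<le> 144 / row_scale n i + 80 / q" .
  qed
  finally show ?thesis .
qed

text \<open>With \<alpha> the scale of the row, the numerator is at most q^2 \<alpha>^2 / 4 and the
  denominator at least (q \<alpha> / 4)^2 in modulus, so each of the 2 N summands is at most
  4.\<close>

lemma norm_lead_cgf''_le:
  assumes NK: "N \<le> n" "real K \<le> q" and q: "q > 0" and u: "norm u \<le> q / 4"
  shows "norm (lead_cgf'' n N K q u) \<le> 8 * real N"
proof -
  have "norm (lead_cgf'' n N K q u) \<le> (\<Sum>i\<in>{1..2*N}. 4)"
    unfolding lead_cgf''_def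
  proof (rule sum_norm_le)
    fix i assume i: "i \<in> {1..2*N}"
    note rb = row_bounds[OF NK(1) i]
    define Z where "Z = of_real (q * row_scale n i) + of_real (row_wt N i) * u"
    have "Re Z \<ge> q * row_scale n i / 4"
    proof -
      have "Re Z = q * row_scale n i + Re (of_real (row_wt N i) * u)" by (simp add: Z_def)
      moreover have "q * row_scale n i > 0" using q rb(1) by simp
      moreover have "Re (of_real (row_wt N i) * u) \<ge> - (q * row_scale n i / 4)"
        using Re_scaled_ge[OF _ rb(2) _ u] q by simp
      ultimately show ?thesis by linarith
    qed
    then have Z: "norm Z \<ge> q * row_scale n i / 4" using complex_Re_le_cmod[of Z] by linarith
    have K: "0 \<le> real K * (real K - 1)" by (cases K) auto
    have "real K * (real K - 1) \<le> q * q"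
      using NK q by (cases "K = 0") (auto intro!: mult_mono)
    then have "real K * (real K - 1) / 4 * (real (row_wt N i))\<^sup>2 \<le> q * q / 4 * (row_scale n i)\<^sup>2"
      using rb q K by (intro mult_mono[of "real K * (real K - 1) / 4"] power_mono) auto
    then have "real K * (real K - 1) / 4 * (real (row_wt N i))\<^sup>2 / (norm Z)\<^sup>2 \<le>
       (q * q / 4 * (row_scale n i)\<^sup>2) / (q * row_scale n i / 4)\<^sup>2"
      using rb q Z by (intro frac_le power_mono) auto
    also have "\<dots> = 4" using rb q by (simp add: field_simps power2_eq_square)
    finally show "norm (of_real (real K * (real K - 1) / 4 * (real (row_wt N i))\<^sup>2) / Z\<^sup>2) \<le> 4"
      unfolding norm_divide norm_power norm_of_real using K by (subst abs_of_nonneg) auto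
  qed
  then show ?thesis by simp
qed

lemma has_field_derivative_lead_cgf''_0:
  assumes NK: "N \<le> n" and q: "q > 0"
  shows "(lead_cgf'' n N K q has_field_derivative
      of_real (- (real K * (real K - 1) / (2 * q ^ 3)) * (\<Sum>i\<in>{1..2*N}. (real (row_wt N i) / row_scale n i) ^ 3))) (at 0)"
proof -
  have "((\<lambda>u. of_real (real K * (real K - 1) / 4 * (real (row_wt N i))\<^sup>2) /
     (of_real (q * row_scale n i) + of_real (row_wt N i) * u)\<^sup>2) has_field_derivative
     of_real (- (real K * (real K - 1) / (2 * q ^ 3)) * ((real (row_wt N i) / row_scale n i) ^ 3))) (at 0)"
    if i: "i \<in> {1..2*N}" for i
  proof -
    define A where "A = q * row_scale n i"
    define c where "c = real (row_wt N i)"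
    define k where "k = real K * (real K - 1) / 4 * c\<^sup>2"
    have A: "A > 0" "row_scale n i > 0" using row_bounds(1)[OF NK i] q by (auto simp: A_def)
    have "((\<lambda>u. of_real k / (of_real A + of_real c * u)\<^sup>2) has_field_derivative of_real (- 2 * k * c / A ^ 3)) (at 0)"
      by (rule derivative_eq_intros refl | use A in \<open>simp add: field_simps power2_eq_square power3_eq_cube\<close>)+
    also have "- 2 * k * c / A ^ 3 = - (real K * (real K - 1) / (2 * q ^ 3)) * ((real (row_wt N i) / row_scale n i) ^ 3)"
      using A q by (simp add: k_def c_def A_def field_simps power2_eq_square power3_eq_cube)
    finally show ?thesis unfolding k_def A_def c_def by simp
  qed
  then have "((\<lambda>u. lead_cgf'' n N K q u) has_field_derivative
      (\<Sum>i\<in>{1..2*N}. of_real (- (real K * (real K - 1) / (2 * q ^ 3)) * ((real (row_wt N i) / row_scale n i) ^ 3)))) (at 0)"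
    unfolding lead_cgf''_def by (intro DERIV_sum)
  then show ?thesis by (simp add: sum_distrib_left)
qed

lemma lead_cgf''_0:
  assumes "N \<le> n" "q > 0"
  shows "lead_cgf'' n N K q 0 = of_real (real K * (real K - 1) / (4 * q\<^sup>2) * (\<Sum>i\<in>{1..2*N}. (real (row_wt N i) / row_scale n i)\<^sup>2))"
  unfolding lead_cgf''_def by (simp add: sum_distrib_left power_divide power_mult_distrib mult_ac)

section \<open>Riemann sums and the harmonic error sum\<close>

lemma tendsto_div_nat:
  fixes x :: "nat \<Rightarrow> real"
  assumes "\<forall>\<^sub>F n in sequentially. \<bar>x n - real n * y\<bar> \<le> C"
  shows "(\<lambda>n. x n / real n) \<longlonglongrightarrow> y"
proof (rule LIM_zero_cancel, rule Lim_null_comparison)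
  show "\<forall>\<^sub>F n in sequentially. norm (x n / real n - y) \<le> C / real n"
    using assms eventually_gt_at_top[of 0]
  proof eventually_elim
    case (elim n)
    then have "x n / real n - y = (x n - real n * y) / real n" by (simp add: field_simps)
    then show ?case using elim by (simp add: divide_right_mono)
  qed
  show "(\<lambda>n. C / real n) \<longlonglongrightarrow> 0" by real_asymp
qed

text \<open>The sum is only logarithmic, but any bound of order o(m) serves, and the square root has
  a short induction. With s = sqrt(m+1), the step asks for sqrt m <= s - 1/(2 s^2). The square of
  the right-hand side is at least s^2 - 1/s, hence at least s^2 - 1 = m.\<close>

lemma harm_le_sqrt: "(\<Sum>k\<in>{1..m}. 1 / real k) \<le> 2 * sqrt (real m)"
proof (induction m)
  case (Suc m)
  define s where "s = sqrt (real (Suc m))"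
  have s: "s \<ge> 1" "real (Suc m) = s\<^sup>2" by (simp_all add: s_def)
  have "sqrt (real m) \<le> s - 1 / (2 * s\<^sup>2)"
  proof (rule real_le_lsqrt)
    have "(s - 1 / (2 * s\<^sup>2))\<^sup>2 = s\<^sup>2 - 1 / s + (1 / (2 * s\<^sup>2))\<^sup>2"
      using s(1) by (simp add: power2_diff) (simp add: power2_eq_square)
    moreover have "1 / s \<le> 1" using s(1) by simp
    moreover have "real m = s\<^sup>2 - 1" using s(2) by simp
    ultimately show "real m \<le> (s - 1 / (2 * s\<^sup>2))\<^sup>2"
      using zero_le_power2[of "1 / (2 * s\<^sup>2)"] by linarith
    have "1 \<le> s\<^sup>2" using s(1) by (rule one_le_power)
    then have "1 / (2 * s\<^sup>2) \<le> 1" by (subst divide_le_eq_1_pos) linarith+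
    then show "0 \<le> s - 1 / (2 * s\<^sup>2)" using s(1) by linarith
  qed
  then show ?case using Suc by (simp add: s(2) s_def[symmetric] del: of_nat_Suc)
qed simp

text \<open>Counting rows from the other end, k = 2 n + 2 - i, turns \<open>row_scale n i\<close>
  into k/2 and the sum into a harmonic one.\<close>

lemma tendsto_sum_inverse_row_scale:
  assumes N: "\<And>n. N n \<le> n"
  shows "(\<lambda>n. (\<Sum>i\<in>{1..2 * N n}. 1 / row_scale n i) / real n) \<longlonglongrightarrow> 0"
proof (rule Lim_null_comparison)
  show "(\<lambda>n. 4 * sqrt (real (2 * n + 1)) / real n) \<longlonglongrightarrow> 0" by real_asymp
  show "\<forall>\<^sub>F n in sequentially. norm ((\<Sum>i\<in>{1..2 * N n}. 1 / row_scale n i) / real n) \<le> 4 * sqrt (real (2 * n + 1)) / real n"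
  proof (intro always_eventually allI)
    fix n
    have pos: "0 \<le> 1 / row_scale n i" if "i \<in> {1..2 * n}" for i
      using that by (auto simp: row_scale_def)
    have sub: "{1..2 * N n} \<subseteq> {1..2 * n}" using N[of n] by auto
    have "(\<Sum>i\<in>{1..2 * N n}. 1 / row_scale n i) \<le> (\<Sum>i\<in>{1..2 * n}. 1 / row_scale n i)"
      using sub pos by (intro sum_mono2) auto
    also have "\<dots> = (\<Sum>k\<in>{2..2*n+1}. 2 * (1 / real k))"
      by (rule sum.reindex_bij_witness[of _ "\<lambda>k. 2*n+2-k" "\<lambda>i. 2*n+2-i"]) (auto simp: row_scale_def of_nat_diff)
    also have "\<dots> \<le> (\<Sum>k\<in>{1..2*n+1}. 2 * (1 / real k))"
      by (intro sum_mono2) auto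
    also have "\<dots> = 2 * (\<Sum>k\<in>{1..2*n+1}. 1 / real k)" by (simp only: sum_distrib_left)
    also have "\<dots> \<le> 2 * (2 * sqrt (real (2*n+1)))"
      by (intro mult_left_mono harm_le_sqrt) simp
    finally have "(\<Sum>i\<in>{1..2 * N n}. 1 / row_scale n i) \<le> 4 * sqrt (real (2*n+1))" by simp
    moreover have "0 \<le> (\<Sum>i\<in>{1..2 * N n}. 1 / row_scale n i)"
      using sub pos by (intro sum_nonneg) blast
    ultimately show "norm ((\<Sum>i\<in>{1..2 * N n}. 1 / row_scale n i) / real n) \<le> 4 * sqrt (real (2 * n + 1)) / real n"
      by (simp add: divide_right_mono)
  qed
qed

text \<open>The sums are integrals of step functions, to which dominated convergence applies.\<close>

lemma
  fixes t :: real
  assumes t: "0 < t" "t \<le> 1"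
  defines "N \<equiv> \<lambda>n. nat \<lfloor>real n * t\<rfloor>"
  shows tendsto_row_sum: "(\<lambda>n. (\<Sum>i\<in>{1..2 * N n}. (real (row_wt (N n) i) / row_scale n i) ^ k) / real n)
     \<longlonglongrightarrow> 2 * integral {0..t} (\<lambda>x. ((t - x) / (1 - x)) ^ k)"
    and integrable_row_limit: "(\<lambda>x. ((t - x) / (1 - x)) ^ k) integrable_on {0..t}"
proof -
  let ?f = "\<lambda>x. ((t - x) / (1 - x)) ^ k"
  define v where "v n i = (real (row_wt (N n) i) / row_scale n i) ^ k" for n i
  \<comment> \<open>Row i owns the cell of length 1/(2n) that ends at i/(2n), so a positive x lies
    in the cell of row \<lceil>2 n x\<rceil> and in no other.\<close>
  define I where "I n i = {(real i - 1) / (2 * real n)<..real i / (2 * real n)}" for n i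
  define g where "g n x = (\<Sum>i\<in>{1..2 * N n}. v n i * indicator (I n i) x)" for n :: nat and x :: real
  define F where "F x = ?f x * indicator {0<..<t} x" for x :: real
  have Nn: "N n \<le> n" for n
  proof -
    have "real n * t \<le> real n" using t by (simp add: mult_left_le)
    then show ?thesis unfolding N_def by linarith
  qed
  have Nt: "\<bar>real (N n) - real n * t\<bar> \<le> 1" for n
  proof -
    have "0 \<le> real n * t" using t by simp
    then show ?thesis unfolding N_def by linarith
  qed
  have v01: "0 \<le> v n i" "v n i \<le> 1" if "i \<in> {1..2 * N n}" for n i
    using row_bounds[OF Nn that] unfolding v_def by (auto intro!: power_le_one)
  have g_eq: "g n x = (if i \<in> {1..2 * N n} then v n i else 0)"
    if n: "n > 0" and i: "i = nat \<lceil>2 * real n * x\<rceil>" and x: "x > 0" for n x i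
  proof -
    have ind: "indicator (I n i') x = (if i' = i then 1 else 0 :: real)" for i'
    proof -
      have "x \<in> I n i' \<longleftrightarrow> real i' - 1 < 2 * real n * x \<and> 2 * real n * x \<le> real i'"
        using n by (simp add: I_def field_simps)
      also have "\<dots> \<longleftrightarrow> i' = i"
      proof -
        have "0 < 2 * real n * x" using n x by simp
        then show ?thesis unfolding i by linarith
      qed
      finally show ?thesis by (simp add: indicator_def)
    qed
    have "g n x = (\<Sum>i'\<in>{1..2 * N n}. if i' = i then v n i' else 0)"
      unfolding g_def ind by (intro sum.cong) auto
    then show ?thesis by simp
  qed
  have meas_g [measurable]: "g n \<in> borel_measurable lborel" for n
    unfolding g_def I_def by measurable
  have meas_F [measurable]: "F \<in> borel_measurable lborel"
    unfolding F_def by measurable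
  have bound: "norm (g n x) \<le> indicator {0..1} x" if "n > 0" for n x
  proof (cases "x > 0")
    case True
    define i where "i = nat \<lceil>2 * real n * x\<rceil>"
    have "x \<le> 1" if "i \<le> 2 * N n"
    proof -
      have "2 * real n * x \<le> real i" unfolding i_def by linarith
      also have "\<dots> \<le> 2 * real n * 1" using that Nn[of n] by simp
      finally show ?thesis using \<open>n > 0\<close> by simp
    qed
    then show ?thesis using g_eq[OF \<open>n > 0\<close> i_def True] v01[of i n] True by auto
  next
    case False
    have "x \<notin> I n i" if "i \<in> {1..2 * N n}" for i
    proof -
      have "0 \<le> (real i - 1) / (2 * real n)" using that by simp
      then show ?thesis using False by (auto simp: I_def)
    qed
    then have "g n x = 0" unfolding g_def by (intro sum.neutral) auto
    then show ?thesis by simp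
  qed
  have lim: "(\<lambda>n. g n x) \<longlonglongrightarrow> F x" if x: "x \<noteq> t" for x
  proof (cases "x > 0")
    case True
    define i where "i n = nat \<lceil>2 * real n * x\<rceil>" for n
    have ix: "\<bar>real (i n) - real n * (2 * x)\<bar> \<le> 1" for n
    proof -
      have "0 \<le> 2 * real n * x" using True by simp
      then show ?thesis unfolding i_def by linarith
    qed
    have ev: "\<forall>\<^sub>F n in sequentially. g n x = (if i n \<in> {1..2 * N n} then v n (i n) else 0)"
      using eventually_gt_at_top[of 0] by eventually_elim (rule g_eq[OF _ i_def True])
    have gt1: "\<forall>\<^sub>F n in sequentially. real n * y > 10" if "y > 0" for y
      using that by real_asymp
    show ?thesis
    proof (cases "x < t")
      case xt: True
      have gt2: "\<forall>\<^sub>F n in sequentially. real n * (t - x) > 10" using gt1[of "t - x"] xt by simp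
      have ev': "\<forall>\<^sub>F n in sequentially. i n \<in> {1..2 * N n}"
        using gt1[OF True] gt2
      proof eventually_elim
        case (elim n)
        have "1 \<le> real (i n)" "real (i n) \<le> 2 * real (N n)"
          using elim ix[of n] Nt[of n] unfolding right_diff_distrib abs_le_iff by linarith+
        then show ?case by simp
      qed
      \<comment> \<open>In row i close to 2 n x the exponent is about n (t - x) and the scale about
        n (1 - x), both up to a bounded error from rounding; their quotient is the
        integrand.\<close>
      have c: "(\<lambda>n. real (row_wt (N n) (i n)) / real n) \<longlonglongrightarrow> t - x"
      proof (rule tendsto_div_nat[where C = 3])
        show "\<forall>\<^sub>F n in sequentially. \<bar>real (row_wt (N n) (i n)) - real n * (t - x)\<bar> \<le> 3"
          using ev'
        proof eventually_elim
          case (elim n)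
          then have "real (row_wt (N n) (i n)) = real (N n) - real (i n div 2)"
            by (auto simp: row_wt_def of_nat_diff)
          moreover have "2 * real (i n div 2) \<le> real (i n)" "2 * real (i n div 2) \<ge> real (i n) - 1" by linarith+
          ultimately show ?case using ix[of n] Nt[of n] by (simp add: algebra_simps)
        qed
      qed
      have a: "(\<lambda>n. row_scale n (i n) / real n) \<longlonglongrightarrow> 1 - x"
      proof (rule tendsto_div_nat[where C = 3], intro always_eventually allI)
        fix n
        show "\<bar>row_scale n (i n) - real n * (1 - x)\<bar> \<le> 3"
          using ix[of n] unfolding row_scale_def abs_le_iff by (simp add: field_simps)
      qed
      have "(\<lambda>n. ((real (row_wt (N n) (i n)) / real n) / (row_scale n (i n) / real n)) ^ k) \<longlonglongrightarrow> ?f x"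
        using xt t by (intro tendsto_intros c a) auto
      moreover have "\<forall>\<^sub>F n in sequentially. ((real (row_wt (N n) (i n)) / real n) / (row_scale n (i n) / real n)) ^ k = g n x"
        using ev ev' eventually_gt_at_top[of 0] by eventually_elim (simp add: v_def)
      ultimately have "(\<lambda>n. g n x) \<longlonglongrightarrow> ?f x" by (rule Lim_transform_eventually)
      then show ?thesis using xt True by (simp add: F_def)
    next
      case False
      have gt2: "\<forall>\<^sub>F n in sequentially. real n * (x - t) > 10" using gt1[of "x - t"] x False by simp
      have "\<forall>\<^sub>F n in sequentially. g n x = 0"
        using ev gt2
      proof eventually_elim
        case (elim n)
        have "2 * real (N n) < real (i n)"
          using elim ix[of n] Nt[of n] unfolding right_diff_distrib abs_le_iff by linarith
        then show ?case using elim(1) by simp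
      qed
      then show ?thesis using False by (simp add: F_def tendsto_eventually)
    qed
  next
    case False
    have "\<forall>\<^sub>F n in sequentially. g n x = 0"
      using eventually_gt_at_top[of 0]
    proof eventually_elim
      case (elim n)
      have "x \<notin> I n i" if "i \<in> {1..2 * N n}" for i
      proof -
        have "0 \<le> (real i - 1) / (2 * real n)" using that by simp
        then show ?thesis using False by (auto simp: I_def)
      qed
      then show ?case unfolding g_def by (intro sum.neutral) auto
    qed
    then show ?thesis using False by (simp add: F_def tendsto_eventually)
  qed
  \<comment> \<open>The point x = t, where no limit is claimed, is a null set. Passing to
    \<open>Suc n\<close> secures the positive index on which the bound relies.\<close>
  have AE_lim: "AE x in lborel. (\<lambda>n. g (Suc n) x) \<longlonglongrightarrow> F x"
    using AE_lborel_singleton[of t] by eventually_elim (use lim LIMSEQ_Suc in blast)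
  have int_w: "integrable lborel (indicator {0..1::real} :: real \<Rightarrow> real)" by simp
  have AE_bound: "AE x in lborel. norm (g (Suc n) x) \<le> indicator {0..1} x" for n
    using bound by simp
  \<comment> \<open>Integrability of the limit comes with domination, so the vanishing denominator
    at x = 1 for t = 1 needs no separate treatment.\<close>
  have int_F: "integrable lborel F"
    by (rule integrable_dominated_convergence[OF _ _ int_w AE_lim AE_bound]) measurable
  have "(\<lambda>n. integral\<^sup>L lborel (g (Suc n))) \<longlonglongrightarrow> integral\<^sup>L lborel F"
    by (rule integral_dominated_convergence[OF _ _ int_w AE_lim AE_bound]) measurable
  moreover have "integral\<^sup>L lborel (g (Suc n)) = (\<Sum>i\<in>{1..2 * N (Suc n)}. v (Suc n) i) / (2 * real (Suc n))" for n
  proof -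
    \<comment> \<open>Cells have length 1/(2n) while the claim divides the sum by n; this is the
      factor 2 in front of the limiting integral.\<close>
    have I: "measure lborel (I (Suc n) i) = 1 / (2 * real (Suc n))" for i
      unfolding I_def by (subst measure_lborel_Ioc) (auto simp: divide_right_mono diff_divide_distrib[symmetric] simp del: of_nat_Suc)
    have fin: "emeasure lborel (I (Suc n) i) < \<infinity>" for i
      unfolding I_def by (subst emeasure_lborel_Ioc) (auto simp: divide_right_mono simp del: of_nat_Suc)
    have "integral\<^sup>L lborel (g (Suc n)) = (\<Sum>i\<in>{1..2 * N (Suc n)}. integral\<^sup>L lborel (\<lambda>x. v (Suc n) i * indicator (I (Suc n) i) x))"
      unfolding g_def by (rule Bochner_Integration.integral_sum) (use fin in \<open>auto simp: I_def intro!: integrable_mult_right\<close>)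
    also have "\<dots> = (\<Sum>i\<in>{1..2 * N (Suc n)}. v (Suc n) i * (1 / (2 * real (Suc n))))"
      by (simp add: I del: of_nat_Suc)
    finally show ?thesis by (simp add: sum_divide_distrib del: of_nat_Suc)
  qed
  ultimately have "(\<lambda>n. (\<Sum>i\<in>{1..2 * N (Suc n)}. v (Suc n) i) / (2 * real (Suc n))) \<longlonglongrightarrow> integral\<^sup>L lborel F"
    by simp
  from tendsto_mult_left[OF LIMSEQ_imp_Suc[OF this], of 2]
  have L: "(\<lambda>n. (\<Sum>i\<in>{1..2 * N n}. v n i) / real n) \<longlonglongrightarrow> 2 * integral\<^sup>L lborel F"
    by simp
  have si: "set_integrable lborel {0<..<t} ?f"
    using int_F by (simp add: set_integrable_def F_def[abs_def] mult.commute)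
  have "integral\<^sup>L lborel F = (LINT x:{0<..<t}|lborel. ?f x)"
    by (simp add: set_lebesgue_integral_def F_def[abs_def] mult.commute)
  also have "\<dots> = integral {0..t} ?f"
    using set_borel_integral_eq_integral(2)[OF si] by (simp add: integral_open_interval_real)
  finally show "(\<lambda>n. (\<Sum>i\<in>{1..2 * N n}. (real (row_wt (N n) i) / row_scale n i) ^ k) / real n)
     \<longlonglongrightarrow> 2 * integral {0..t} (\<lambda>x. ((t - x) / (1 - x)) ^ k)"
    using L by (simp add: v_def)
  show "?f integrable_on {0..t}"
    using set_borel_integral_eq_integral(1)[OF si] by (simp add: integrable_on_Icc_iff_Ioo)
qed

section \<open>Cumulant generating function of the whole array\<close>

definition array_cgf :: "nat \<Rightarrow> nat \<Rightarrow> nat \<Rightarrow> real \<Rightarrow> complex \<Rightarrow> complex" where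
  "array_cgf n N K q u = (\<Sum>i\<in>{1..2*N}.
     (\<Sum>j<K. beta_cgf (q * row_scale n i - real j / 2) (q * row_scale n i) (row_wt1 N i) (row_wt N i) u) +
     (\<Sum>j\<in>{1..<K}. beta_cgf (q * row_scale n i - real j / 2) (real j / 2) (row_wt N i) 0 u))"

definition array_cgf' :: "nat \<Rightarrow> nat \<Rightarrow> nat \<Rightarrow> real \<Rightarrow> complex \<Rightarrow> complex" where
  "array_cgf' n N K q u = (\<Sum>i\<in>{1..2*N}.
     (\<Sum>j<K. beta_cgf' (q * row_scale n i - real j / 2) (q * row_scale n i) (row_wt1 N i) (row_wt N i) u) +
     (\<Sum>j\<in>{1..<K}. beta_cgf' (q * row_scale n i - real j / 2) (real j / 2) (row_wt N i) 0 u))"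

text \<open>Of a parameter A = q \<open>row_scale n i\<close>, at least q, the shift j/2 takes at
  most half and the term with \<open>u\<close> at most a quarter. The disc of radius q/4 is thus a
  common domain for all variables of the array.\<close>

lemma array_params_pos:
  assumes NK: "N \<le> n" and q: "q > 0" and u: "norm u < q / 4" and i: "i \<in> {1..2*N}" and jq: "real j \<le> q"
  shows "0 < Re (of_real (q * row_scale n i - real j / 2) + of_real (row_wt1 N i) * u)"
    "0 < Re (of_real (q * row_scale n i) + of_real (row_wt N i) * u)"
    "0 < Re (of_real (q * row_scale n i - real j / 2) + of_real (row_wt N i) * u)"
proof -
  note rb = row_bounds[OF NK i]
  have A: "q * row_scale n i > 0" "q * row_scale n i \<ge> q" using q rb(1) by auto
  have "Re (of_real (row_wt1 N i) * u) \<ge> - (q * row_scale n i / 4)"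
    "Re (of_real (row_wt N i) * u) \<ge> - (q * row_scale n i / 4)"
    using Re_scaled_ge[OF _ rb(2), of q u] Re_scaled_ge[OF _ rb(3), of q u] q u by auto
  then show "0 < Re (of_real (q * row_scale n i - real j / 2) + of_real (row_wt1 N i) * u)"
    "0 < Re (of_real (q * row_scale n i) + of_real (row_wt N i) * u)"
    "0 < Re (of_real (q * row_scale n i - real j / 2) + of_real (row_wt N i) * u)"
    unfolding plus_complex.simps Re_complex_of_real using A jq by linarith+
qed

lemma has_field_derivative_array_cgf:
  assumes "N \<le> n" "real K \<le> q" "q > 0" "norm u < q / 4"
  shows "(array_cgf n N K q has_field_derivative array_cgf' n N K q u) (at u)"
    and "(array_cgf' n N K q has_field_derivative array_cgf'' n N K q u) (at u)"
proof -
  note pos = array_params_pos(1,3)[OF assms(1,3,4)] array_params_pos(2)[OF assms(1,3,4), of _ 0]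
  have jq: "real j \<le> q" if "j < K" for j using that assms(2) by linarith
  show "(array_cgf n N K q has_field_derivative array_cgf' n N K q u) (at u)"
    unfolding array_cgf_def array_cgf'_def
    by (intro DERIV_sum DERIV_add has_field_derivative_beta_cgf) (use pos jq assms(3) in auto)
  show "(array_cgf' n N K q has_field_derivative array_cgf'' n N K q u) (at u)"
    unfolding array_cgf'_def array_cgf''_def
    by (intro DERIV_sum DERIV_add has_field_derivative_beta_cgf') (use pos jq assms(3) in auto)
qed

lemma array_cgf_0 [simp]: "array_cgf n N K q 0 = 0"
  by (simp add: array_cgf_def)

text \<open>Scales and q are at least 1, so the approximation error is at most 2 N (144 + 80);
  adding 8 N for the leading sum gives 456 N. This crude O(n) bound is the input to the Taylor
  remainder.\<close>

lemma norm_array_cgf''_le: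
  assumes NK: "N \<le> n" "real K \<le> q" and q: "q \<ge> 1" and u: "norm u \<le> q / 4"
  shows "norm (array_cgf'' n N K q u) \<le> 456 * real n"
proof -
  have q0: "q > 0" using q by simp
  have "norm (array_cgf'' n N K q u) \<le> norm (array_cgf'' n N K q u - lead_cgf'' n N K q u) + norm (lead_cgf'' n N K q u)"
    using norm_triangle_ineq[of "array_cgf'' n N K q u - lead_cgf'' n N K q u" "lead_cgf'' n N K q u"] by simp
  also have "\<dots> \<le> (\<Sum>i\<in>{1..2*N}. 144 / row_scale n i + 80 / q) + 8 * real N"
    by (intro add_mono array_cgf''_approx norm_lead_cgf''_le NK q0 u)
  also have "(\<Sum>i\<in>{1..2*N}. 144 / row_scale n i + 80 / q) \<le> (\<Sum>i\<in>{1..2*N}. 144 + 80)"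
    using row_bounds(1)[OF NK(1)] q by (intro sum_mono add_mono) (auto simp: divide_le_eq)
  finally show ?thesis using NK by simp
qed

text \<open>The approximation of the second derivatives is uniform on a disc, so it may be
  differentiated: Cauchy's inequality on the circle of radius q/8 costs the factor 8/q. This circle
  lies inside the open disc of radius q/4 on which both functions are holomorphic.\<close>

lemma array_deriv3_approx:
  assumes NK: "N \<le> n" "real K \<le> q" and q: "q > 0"
  shows "norm (deriv (array_cgf'' n N K q) 0 -
      of_real (- (real K * (real K - 1) / (2 * q ^ 3)) * (\<Sum>i\<in>{1..2*N}. (real (row_wt N i) / row_scale n i) ^ 3)))
    \<le> 8 * (\<Sum>i\<in>{1..2*N}. 144 / row_scale n i + 80 / q) / q"
proof -
  let ?f = "array_cgf'' n N K q" and ?g = "lead_cgf'' n N K q"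
  have "array_cgf' n N K q holomorphic_on ball 0 (q/4)"
    unfolding holomorphic_on_open[OF open_ball] using has_field_derivative_array_cgf(2)[OF NK q] by (metis mem_ball_0)
  then have "deriv (array_cgf' n N K q) holomorphic_on ball 0 (q/4)" by (rule holomorphic_deriv) auto
  then have hol: "?f holomorphic_on ball 0 (q/4)"
    by (rule holomorphic_transform) (use has_field_derivative_array_cgf(2)[OF NK q] DERIV_imp_deriv in auto)
  have nz: "of_real (q * row_scale n i) + of_real (row_wt N i) * u \<noteq> 0" if "i \<in> {1..2*N}" "norm u < q/4" for i and u :: complex
  proof -
    have "0 < Re (of_real (q * row_scale n i) + of_real (row_wt N i) * u)"
      by (rule array_params_pos(2)[OF NK(1) q that(2,1), of 0]) (use q in simp)
    then show ?thesis by (metis less_irrefl zero_complex.simps(1))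
  qed
  have holg: "?g holomorphic_on ball 0 (q/4)"
    unfolding lead_cgf''_def using nz by (intro holomorphic_intros) auto
  have df: "(?f has_field_derivative deriv ?f 0) (at 0)"
    using holomorphic_derivI[OF hol, of 0] q by simp
  have "deriv (\<lambda>u. ?f u - ?g u) 0 = deriv ?f 0 -
      of_real (- (real K * (real K - 1) / (2 * q ^ 3)) * (\<Sum>i\<in>{1..2*N}. (real (row_wt N i) / row_scale n i) ^ 3))"
    by (intro DERIV_imp_deriv DERIV_diff df has_field_derivative_lead_cgf''_0 NK q)
  moreover have "norm ((deriv ^^ 1) (\<lambda>u. ?f u - ?g u) 0) \<le> fact 1 * (\<Sum>i\<in>{1..2*N}. 144 / row_scale n i + 80 / q) / (q / 8) ^ 1"
  proof (rule Cauchy_inequality)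
    have sub: "ball 0 (q/8) \<subseteq> ball (0::complex) (q/4)" "cball 0 (q/8) \<subseteq> ball (0::complex) (q/4)" using q by auto
    show "(\<lambda>u. ?f u - ?g u) holomorphic_on ball 0 (q/8)"
      by (intro holomorphic_on_diff holomorphic_on_subset[OF hol] holomorphic_on_subset[OF holg] sub)
    show "continuous_on (cball 0 (q/8)) (\<lambda>u. ?f u - ?g u)"
      by (intro continuous_on_diff holomorphic_on_imp_continuous_on holomorphic_on_subset[OF hol] holomorphic_on_subset[OF holg] sub)
    show "norm (?f x - ?g x) \<le> (\<Sum>i\<in>{1..2*N}. 144 / row_scale n i + 80 / q)" if "norm (0 - x) = q / 8" for x
      using that q by (intro array_cgf''_approx NK q) auto
  qed (use q in auto)
  ultimately show ?thesis by (simp add: mult_ac)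
qed

section \<open>Identification of the process with a sum over the array\<close>

lemma sum_pairs:
  fixes f :: "nat \<Rightarrow> 'b :: comm_monoid_add"
  shows "(\<Sum>i\<in>{1..2*N}. f i) = (\<Sum>m\<in>{1..N}. f (2*m) + f (2*m - 1))"
proof (induction N)
  case (Suc N)
  have "{1..2 * Suc N} = insert (2 * Suc N) (insert (2 * Suc N - 1) {1..2*N})" by auto
  then show ?case using Suc by (simp add: add_ac)
qed simp

lemma sum_array_index:
  fixes F :: "nat \<times> nat + nat \<times> nat \<Rightarrow> 'b :: comm_monoid_add"
  assumes "finite A" "finite B" "finite C"
  shows "sum F ((A \<times> B) <+> (A \<times> C)) = (\<Sum>i\<in>A. (\<Sum>j\<in>B. F (Inl (i, j))) + (\<Sum>j\<in>C. F (Inr (i, j))))"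
  using assms by (simp add: sum.Plus sum.distrib sum.cartesian_product case_prod_unfold)

text \<open>The factor \<open>(1 - R n i j \<omega>) ^ 0\<close> gives the r-summands the same shape
  X^k (1-X)^l as the p-summands, so that one lemma on independent Beta variables covers both. Even
  and odd rows merge because \<open>row_wt\<close> and \<open>row_wt1\<close> absorb the parity
  through \<open>div 2\<close>.\<close>

lemma Hproc_eq_sum:
  fixes P R :: "nat \<Rightarrow> nat \<Rightarrow> nat \<Rightarrow> 'a \<Rightarrow> real" and s t :: real and n :: nat and p :: "nat \<Rightarrow> nat"
  defines "N \<equiv> nat \<lfloor>real n * t\<rfloor>" and "K \<equiv> nat \<lfloor>real (p n) * s\<rfloor>"
  shows "Hproc p P R s t n \<omega> = (\<Sum>i\<in>{1..2 * N}.
     (\<Sum>j\<in>{0..<K}. ln (P n i j \<omega> ^ row_wt1 (N) i * (1 - P n i j \<omega>) ^ row_wt (N) i)) +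
     (\<Sum>j\<in>{1..<K}. ln (R n i j \<omega> ^ row_wt (N) i * (1 - R n i j \<omega>) ^ 0)))"
  unfolding Hproc_def Let_def N_def[symmetric] K_def[symmetric] sum_pairs
proof (rule sum.cong)
  fix m assume m: "m \<in> {1..N}"
  have w: "row_wt (N) (2 * m) = N - m" "row_wt1 (N) (2 * m) = N - m + 1"
    "row_wt (N) (2 * m - 1) = N - m + 1" "row_wt1 (N) (2 * m - 1) = N - m + 1"
  proof -
    obtain k where k: "m = Suc k" using m by (cases m) auto
    have "(2 * m - 1) div 2 = k" "(2 * m - 1 + 1) div 2 = m" "(2 * m + 1) div 2 = m" using k by auto
    then show "row_wt (N) (2 * m) = N - m" "row_wt1 (N) (2 * m) = N - m + 1"
      "row_wt (N) (2 * m - 1) = N - m + 1" "row_wt1 (N) (2 * m - 1) = N - m + 1"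
      unfolding row_wt_def row_wt1_def using m k by auto
  qed
  show "(\<Sum>j\<in>{1..<K}. ln (R n (2*m) j \<omega> ^ (N - m)) + ln (R n (2*m - 1) j \<omega> ^ (N - m + 1))) +
        (\<Sum>j\<in>{0..<K}. ln (P n (2*m) j \<omega> ^ (N - m + 1) * (1 - P n (2*m) j \<omega>) ^ (N - m))) +
        (\<Sum>j\<in>{0..<K}. ln (P n (2*m - 1) j \<omega> ^ (N - m + 1) * (1 - P n (2*m - 1) j \<omega>) ^ (N - m + 1))) =
     (\<Sum>j\<in>{0..<K}. ln (P n (2*m) j \<omega> ^ row_wt1 (N) (2*m) * (1 - P n (2*m) j \<omega>) ^ row_wt (N) (2*m))) +
     (\<Sum>j\<in>{1..<K}. ln (R n (2*m) j \<omega> ^ row_wt (N) (2*m) * (1 - R n (2*m) j \<omega>) ^ 0)) +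
     ((\<Sum>j\<in>{0..<K}. ln (P n (2*m-1) j \<omega> ^ row_wt1 (N) (2*m-1) * (1 - P n (2*m-1) j \<omega>) ^ row_wt (N) (2*m-1))) +
     (\<Sum>j\<in>{1..<K}. ln (R n (2*m-1) j \<omega> ^ row_wt (N) (2*m-1) * (1 - R n (2*m-1) j \<omega>) ^ 0)))"
    unfolding w by (simp add: sum.distrib)
qed simp

lemma Hproc_cgf:
  fixes M :: "nat \<Rightarrow> 'a measure" and p :: "nat \<Rightarrow> nat"
    and P R :: "nat \<Rightarrow> nat \<Rightarrow> nat \<Rightarrow> 'a \<Rightarrow> real" and s t :: real
  assumes p: "p n > 0" and array: "beta_array M p P R"
    and s: "0 < s" "s \<le> 1" and t: "0 < t" "t \<le> 1"
  defines "N \<equiv> nat \<lfloor>real n * t\<rfloor>" and "K \<equiv> nat \<lfloor>real (p n) * s\<rfloor>" and "q \<equiv> real (p n) + 1"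
  defines "H \<equiv> Hproc p P R s t n"
  shows "H \<in> borel_measurable (M n)"
    and "\<And>x. \<bar>x\<bar> < q / 4 \<Longrightarrow> integrable (M n) (\<lambda>\<omega>. exp (x * H \<omega>))"
    and "\<And>u. norm u < q / 4 \<Longrightarrow> mgf (M n) H u = exp (array_cgf n N K q u)"
    and "of_real (integral\<^sup>L (M n) H) = array_cgf' n N K q 0"
    and "of_real (cumulant (M n) 2 H) = array_cgf'' n N K q 0"
proof -
  interpret prob_space "M n" using array by (simp add: beta_array_def)
  have N: "N \<le> n"
  proof -
    have "real n * t \<le> real n" using t by (simp add: mult_left_le)
    then show ?thesis unfolding N_def by linarith
  qed
  have K: "K \<le> p n"
  proof -
    have "real (p n) * s \<le> real (p n)" using s by (simp add: mult_left_le)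
    then show ?thesis unfolding K_def by linarith
  qed
  have Kq: "real K \<le> q" and q: "q > 0" using K by (auto simp: q_def)
  define Y where "Y = case_sum (\<lambda>(i, j). P n i j) (\<lambda>(i, j). R n i j)"
  define J where "J = ({1..2*N} \<times> {0..<K}) <+> ({1..2*N} \<times> {1..<K})"
  define \<alpha> where "\<alpha> = case_sum (\<lambda>(i, j). q * row_scale n i - real j / 2) (\<lambda>(i, j). q * row_scale n i - real j / 2)"
  define \<beta> where "\<beta> = case_sum (\<lambda>(i, j :: nat). q * row_scale n i) (\<lambda>(i :: nat, j). real j / 2)"
  define k where "k = case_sum (\<lambda>(i, j :: nat). row_wt1 N i) (\<lambda>(i, j :: nat). row_wt N i)"
  define l where "l = case_sum (\<lambda>(i, j :: nat). row_wt N i) (\<lambda>(i :: nat, j :: nat). 0 :: nat)"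
  note defs = Y_def \<alpha>_def \<beta>_def k_def l_def
  have J: "finite J" by (auto simp: J_def)
  \<comment> \<open>As s and t are at most 1, the rows up to 2 N and the columns below K stay inside
    the index set on which independence and the Beta laws are assumed.\<close>
  have sub: "J \<subseteq> ({1..2*n} \<times> {0..p n - 1}) <+> ({1..2*n} \<times> {1..p n - 1})"
    using N K by (auto simp: J_def)
  have indep: "indep_vars (\<lambda>_. borel) Y J"
    using array indep_vars_subset[OF _ sub] unfolding beta_array_def Y_def by blast
  have scale: "(real (p n) + 1) / 2 * (2 * real n - real i + 2) = q * row_scale n i" for i
    by (simp add: q_def row_scale_def)
  have betaP: "beta_distributed (M n) (P n i j) (q * row_scale n i - real j / 2) (q * row_scale n i)"
    if "i \<in> {1..2*n}" "j \<in> {0..p n - 1}" for i j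
    using array that unfolding beta_array_def scale[symmetric] by blast
  have betaR: "beta_distributed (M n) (R n i j) (q * row_scale n i - real j / 2) (real j / 2)"
    if "i \<in> {1..2*n}" "j \<in> {1..p n - 1}" for i j
    using array that unfolding beta_array_def scale[symmetric] by blast
  have beta: "beta_distributed (M n) (Y x) (\<alpha> x) (\<beta> x)" if "x \<in> J" for x
  proof -
    have "x \<in> ({1..2*n} \<times> {0..p n - 1}) <+> ({1..2*n} \<times> {1..p n - 1})" using that sub by blast
    then show ?thesis using betaP betaR by (auto simp: defs)
  qed
  have pos1: "0 < Re (of_real (\<alpha> x) + of_real (k x) * u)" if "x \<in> J" "norm u < q / 4" for x u
    using that array_params_pos(1,3)[OF N q that(2)] Kq by (auto simp: J_def defs)
  have pos2: "0 < Re (of_real (\<beta> x) + of_real (l x) * u)" if "x \<in> J" "norm u < q / 4" for x u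
    using that array_params_pos(2)[OF N q that(2), of _ 0] q by (auto simp: J_def defs)
  have q4: "q / 4 > 0" using q by simp
  have H: "H = (\<lambda>\<omega>. \<Sum>x\<in>J. ln (Y x \<omega> ^ k x * (1 - Y x \<omega>) ^ l x))"
    unfolding H_def Hproc_eq_sum J_def N_def[symmetric] K_def[symmetric]
    by (subst sum_array_index) (auto simp: defs fun_eq_iff)
  note facts = measurable_sum_ln_beta[OF J indep beta q4 pos1 pos2]
    integrable_exp_sum_ln_beta[OF J indep beta q4 pos1 pos2]
    mgf_sum_ln_beta[OF J indep beta q4 pos1 pos2]
    expectation_sum_ln_beta[OF J indep beta q4 pos1 pos2]
    cumulant_sum_ln_beta[OF J indep beta q4 pos1 pos2]
  show "H \<in> borel_measurable (M n)" unfolding H by (rule facts)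
  show "integrable (M n) (\<lambda>\<omega>. exp (x * H \<omega>))" if "\<bar>x\<bar> < q / 4" for x
    unfolding H by (rule facts(2)) (use that in auto)
  have *: "array_cgf n N K q u = (\<Sum>x\<in>J. beta_cgf (\<alpha> x) (\<beta> x) (k x) (l x) u)" for u
    unfolding J_def array_cgf_def by (subst sum_array_index) (auto simp: defs atLeast0LessThan)
  show "mgf (M n) H u = exp (array_cgf n N K q u)" if "norm u < q / 4" for u
  proof -
    have "mgf (M n) H u = exp (\<Sum>x\<in>J. beta_cgf (\<alpha> x) (\<beta> x) (k x) (l x) u)"
      unfolding H by (rule facts(3)) (use that in auto)
    then show ?thesis using * by simp
  qed
  have "array_cgf' n N K q 0 = (\<Sum>x\<in>J. beta_cgf' (\<alpha> x) (\<beta> x) (k x) (l x) 0)"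
    unfolding J_def array_cgf'_def by (subst sum_array_index) (auto simp: defs atLeast0LessThan)
  then show "of_real (integral\<^sup>L (M n) H) = array_cgf' n N K q 0"
    unfolding H using facts(4) by simp
  have "array_cgf'' n N K q 0 = (\<Sum>x\<in>J. beta_cgf'' (\<alpha> x) (\<beta> x) (k x) (l x) 0)"
    unfolding J_def array_cgf''_def by (subst sum_array_index) (auto simp: defs atLeast0LessThan)
  then show "of_real (cumulant (M n) 2 H) = array_cgf'' n N K q 0"
    unfolding H using facts(5) by simp
qed

subsection \<open>The limit theorem\<close>

text \<open>The two inequalities are uniform in p. The first keeps the scaled argument e w well
  inside the disc of radius proportional to p + 1; it follows from p^(1/3) <= p. The second is the
  size of the fourth-order Taylor term and follows from the first, as e^4 n / (p+1)^2 = (p / (p+1))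
  (e / (p+1)).\<close>

lemma frac_cbrt_bounds:
  assumes "n > 0" "p > 0"
  defines "e \<equiv> (real p / real n) powr (1/3)"
  shows "e ^ 3 = real p / real n" "e\<^sup>2 = (real p / real n) powr (2/3)"
    "e / (real p + 1) \<le> real n powr (-1/3)" "e ^ 4 * real n / (real p + 1)\<^sup>2 \<le> real n powr (-1/3)" "e > 0"
proof -
  have pos: "real p / real n > 0" "real n > 0" "real p \<ge> 1" using assms by auto
  show e: "e > 0" using pos by (simp add: e_def)
  show e3: "e ^ 3 = real p / real n" "e\<^sup>2 = (real p / real n) powr (2/3)"
    using pos powr_realpow[OF e, of 3] powr_realpow[OF e, of 2] by (simp_all add: e_def powr_powr)
  have "e = real p powr (1/3) / real n powr (1/3)"
    using pos by (simp add: e_def powr_divide)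
  also have "\<dots> = real p powr (1/3) * real n powr (-1/3)"
    using powr_minus_divide[of "real n" "1/3"] by simp
  also have "\<dots> \<le> real p powr 1 * real n powr (-1/3)"
    using pos by (intro mult_right_mono powr_mono) auto
  finally have "e \<le> real p * real n powr (-1/3)" using pos by simp
  also have "\<dots> \<le> real n powr (-1/3) * (real p + 1)" by (simp add: algebra_simps)
  finally show e1: "e / (real p + 1) \<le> real n powr (-1/3)"
    by (subst pos_divide_le_eq) auto
  have "e ^ 4 * real n / (real p + 1)\<^sup>2 = (e ^ 3 * real n) * e / (real p + 1)\<^sup>2"
    by (simp add: power4_eq_xxxx power3_eq_cube mult_ac)
  also have "\<dots> = real p / (real p + 1) * (e / (real p + 1))"
    using pos unfolding e3(1) by (simp add: power2_eq_square)
  also have "\<dots> \<le> 1 * (real n powr (-1/3))"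
    using e e1 by (intro mult_mono) auto
  finally show "e ^ 4 * real n / (real p + 1)\<^sup>2 \<le> real n powr (-1/3)" by simp
qed

text \<open>On the left half of the interval (t - x) / (1 - x) >= t - x >= t/2. Positivity is needed
  to divide by the leading constant of the speed and to let \<open>g\<close> tend to
  infinity.\<close>

lemma square_integral_pos:
  assumes t: "0 < t" "t \<le> (1::real)"
  shows "integral {0..t} (\<lambda>x. ((t - x) / (1 - x))\<^sup>2) > 0"
proof -
  let ?f = "\<lambda>x. ((t - x) / (1 - x))\<^sup>2"
  have int: "?f integrable_on {0..t}" by (rule integrable_row_limit[OF t])
  have "0 < (t/2) * (t/2)\<^sup>2" using t by simp
  also have "\<dots> = integral {0..t/2} (\<lambda>x. (t/2)\<^sup>2)" using t by simp
  also have "\<dots> \<le> integral {0..t/2} ?f"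
  proof (rule integral_le)
    show "?f integrable_on {0..t/2}" by (rule integrable_on_subinterval[OF int]) (use t in auto)
    show "(t/2)\<^sup>2 \<le> ?f x" if "x \<in> {0..t/2}" for x
    proof (rule power_mono)
      have x: "0 \<le> x" "x \<le> t/2" "x < 1" using that t by auto
      have "t/2 * (1 - x) \<le> t/2" using t x by (simp add: algebra_simps)
      also have "\<dots> \<le> t - x" using x by simp
      finally show "t/2 \<le> (t - x) / (1 - x)" using x by (simp add: pos_le_divide_eq)
    qed (use t in auto)
  qed auto
  also have "\<dots> \<le> integral {0..t} ?f"
    using t by (intro integral_subset_le int integrable_on_subinterval[OF int]) auto
  finally show ?thesis .
qed

text \<open>The moment generating function of the n-th variable is controlled only where
  \<epsilon>_n |Re z| < q_n / 4, and this covers a given strip from some index on. The convergence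
  is therefore stated for the sequence shifted by an \<open>n0\<close> that depends on the strip;
  the shift does not affect the limit.\<close>

theorem theorem5p3:
  fixes M :: "nat \<Rightarrow> 'a measure" and p :: "nat \<Rightarrow> nat"
    and P R :: "nat \<Rightarrow> nat \<Rightarrow> nat \<Rightarrow> 'a \<Rightarrow> real" and s t :: real
  assumes p_pos: "\<And>n. p n > 0"
    and p_lim: "filterlim p at_top sequentially"
    and array: "beta_array M p P R"
    and s: "0 < s" "s \<le> 1" and t: "0 < t" "t \<le> 1"
  shows "let H = Hproc p P R s t;
             X = (\<lambda>n \<omega>. (real (p n) / real n) powr (1/3) * (H n \<omega> - (\<integral>\<omega>'. H n \<omega>' \<partial>M n)));
             \<tau> = (\<lambda>n. (real (p n) / real n) powr (2/3) * cumulant (M n) 2 (H n));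
             g = (\<lambda>n. real n powr (1/3) * real (p n) powr (2/3) * (s\<^sup>2 / 2) *
                   integral {0..t} (\<lambda>x. ((t - x) / (1 - x))\<^sup>2));
             \<psi> = (\<lambda>z::complex. exp (- (z ^ 3) *
                   complex_of_real (s\<^sup>2 / 6 * integral {0..t} (\<lambda>x. ((t - x) / (1 - x)) ^ 3))))
         in (\<forall>a b. a < b \<longrightarrow> (\<exists>n0. mod_gaussian_convergent a b
                (\<lambda>n. M (n + n0)) (\<lambda>n. X (n + n0)) (\<lambda>n. \<tau> (n + n0)) \<psi>)) \<and>
            (\<tau> \<sim>[sequentially] g) \<and>
            filterlim \<tau> at_top sequentially \<and>
            filterlim g at_top sequentially"
proof -
  define H where "H = Hproc p P R s t"
  define \<epsilon> where "\<epsilon> n = (real (p n) / real n) powr (1/3)" for n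
  define X where "X = (\<lambda>n \<omega>. \<epsilon> n * (H n \<omega> - (\<integral>\<omega>'. H n \<omega>' \<partial>M n)))"
  define \<tau> where "\<tau> = (\<lambda>n. (real (p n) / real n) powr (2/3) * cumulant (M n) 2 (H n))"
  define I2 where "I2 = integral {0..t} (\<lambda>x. ((t - x) / (1 - x))\<^sup>2)"
  define I3 where "I3 = integral {0..t} (\<lambda>x. ((t - x) / (1 - x)) ^ 3)"
  define g where "g = (\<lambda>n. real n powr (1/3) * real (p n) powr (2/3) * (s\<^sup>2 / 2) * I2)"
  define \<psi> where "\<psi> = (\<lambda>z::complex. exp (- (z ^ 3) * complex_of_real (s\<^sup>2 / 6 * I3)))"
  define N where "N n = nat \<lfloor>real n * t\<rfloor>" for n
  define K where "K n = nat \<lfloor>real (p n) * s\<rfloor>" for n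
  define q where "q n = real (p n) + 1" for n
  define L where "L n = array_cgf n (N n) (K n) (q n)" for n
  define L' where "L' n = array_cgf' n (N n) (K n) (q n)" for n
  define L'' where "L'' n = array_cgf'' n (N n) (K n) (q n)" for n
  note Hfacts = Hproc_cgf[OF p_pos array s t, folded N_def K_def q_def H_def, folded L_def L'_def L''_def]
  have N: "N n \<le> n" for n
  proof -
    have "real n * t \<le> real n" using t by (simp add: mult_left_le)
    then show ?thesis unfolding N_def by linarith
  qed
  have Kp: "\<bar>real (K n) - real (p n) * s\<bar> \<le> 1" "real (K n) \<le> q n" for n
  proof -
    have "real (p n) * s \<le> real (p n)" "0 \<le> real (p n) * s" using s by (simp_all add: mult_left_le)
    then show "\<bar>real (K n) - real (p n) * s\<bar> \<le> 1" "real (K n) \<le> q n" unfolding K_def q_def by linarith+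
  qed
  have p0 [simp]: "p n \<noteq> 0" for n using p_pos[of n] by simp
  have q: "q n > 0" "q n \<ge> 1" for n by (auto simp: q_def)
  have pr: "filterlim (\<lambda>n. real (p n)) at_top sequentially"
    using p_lim by (rule filterlim_compose[OF filterlim_real_sequentially])

  \<comment> \<open>Limits of the second and third derivatives at 0\<close>
  define S where "S k n = (\<Sum>i\<in>{1..2 * N n}. (real (row_wt (N n) i) / row_scale n i) ^ k)" for k n
  have S: "(\<lambda>n. S k n / real n) \<longlonglongrightarrow> 2 * integral {0..t} (\<lambda>x. ((t - x) / (1 - x)) ^ k)" for k
    using tendsto_row_sum[OF t, of k] by (simp add: S_def N_def)
  define E where "E n = (\<Sum>i\<in>{1..2 * N n}. 144 / row_scale n i + 80 / q n)" for n
  have inv_p: "(\<lambda>n. c / real (p n)) \<longlonglongrightarrow> 0" for c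
    using pr by (intro real_tendsto_divide_at_top[OF tendsto_const])
  have qp: "(\<lambda>n. q n / real (p n)) \<longlonglongrightarrow> 1"
  proof -
    have "(\<lambda>n. 1 + 1 / real (p n)) \<longlonglongrightarrow> 1 + 0" by (intro tendsto_intros inv_p)
    then show ?thesis by (simp add: q_def add_divide_distrib)
  qed
  have inv_q: "(\<lambda>n. c / q n) \<longlonglongrightarrow> 0" for c
  proof -
    have "(\<lambda>n. (c / real (p n)) / (q n / real (p n))) \<longlonglongrightarrow> 0 / 1"
      by (intro tendsto_divide inv_p qp) auto
    then show ?thesis by simp
  qed
  have E_lim: "(\<lambda>n. E n / real n) \<longlonglongrightarrow> 0"
  proof (rule tendsto_sandwich)
    have "0 \<le> E n" for n
      unfolding E_def
    proof (rule sum_nonneg)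
      fix i assume "i \<in> {1..2 * N n}"
      from row_bounds(1)[OF N this] show "0 \<le> 144 / row_scale n i + 80 / q n"
        using q(1)[of n] by simp
    qed
    then show "\<forall>\<^sub>F n in sequentially. 0 \<le> E n / real n" by simp
    show "\<forall>\<^sub>F n in sequentially. E n / real n \<le> 144 * ((\<Sum>i\<in>{1..2 * N n}. 1 / row_scale n i) / real n) + 160 / q n"
      using eventually_gt_at_top[of 0]
    proof eventually_elim
      case (elim n)
      have "E n = 144 * (\<Sum>i\<in>{1..2 * N n}. 1 / row_scale n i) + 160 * real (N n) / q n"
        by (simp add: E_def sum.distrib sum_distrib_left)
      also have "\<dots> \<le> 144 * (\<Sum>i\<in>{1..2 * N n}. 1 / row_scale n i) + 160 * real n / q n"
        using N[of n] q[of n] by (intro add_left_mono divide_right_mono) auto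
      finally show ?case using elim by (simp add: field_simps)
    qed
    show "(\<lambda>n. 144 * ((\<Sum>i\<in>{1..2 * N n}. 1 / row_scale n i) / real n) + 160 / q n) \<longlonglongrightarrow> 0"
      using tendsto_add[OF tendsto_mult_left[OF tendsto_sum_inverse_row_scale[OF N], of 144] inv_q[of 160]] by simp
  qed simp
  have K_lim: "(\<lambda>n. real (K n) * (real (K n) - 1) / (q n)\<^sup>2) \<longlonglongrightarrow> s\<^sup>2"
  proof -
    have Kp_lim: "(\<lambda>n. real (K n) / real (p n)) \<longlonglongrightarrow> s"
    proof (rule LIM_zero_cancel, rule Lim_null_comparison[OF _ inv_p[of 1]], intro always_eventually allI)
      fix n
      have "real (K n) / real (p n) - s = (real (K n) - real (p n) * s) / real (p n)"
        using p_pos[of n] by (simp add: field_simps)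
      then show "norm (real (K n) / real (p n) - s) \<le> 1 / real (p n)"
        using Kp(1)[of n] by (simp add: divide_right_mono)
    qed
    have "(\<lambda>n. (real (K n) / real (p n)) * (real (K n) / real (p n) - 1 / real (p n)) / (q n / real (p n))\<^sup>2) \<longlonglongrightarrow> s * (s - 0) / 1\<^sup>2"
      by (intro tendsto_intros Kp_lim inv_p qp) auto
    moreover have "(real (K n) / real (p n)) * (real (K n) / real (p n) - 1 / real (p n)) / (q n / real (p n))\<^sup>2 =
        real (K n) * (real (K n) - 1) / (q n)\<^sup>2" for n
      using p_pos[of n] q[of n] by (simp add: field_simps power2_eq_square)
    ultimately have "(\<lambda>n. real (K n) * (real (K n) - 1) / (q n)\<^sup>2) \<longlonglongrightarrow> s * (s - 0) / 1\<^sup>2"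
      by (simp only:)
    then show ?thesis by (simp add: power2_eq_square)
  qed

  define c2 where "c2 = s\<^sup>2 / 2 * I2"
  have I2: "I2 > 0" unfolding I2_def by (rule square_integral_pos[OF t])
  have c2: "c2 > 0" using s I2 by (simp add: c2_def)
  define k2 where "k2 n = cumulant (M n) 2 (H n)" for n
  have k2: "L'' n 0 = of_real (k2 n)" for n
    unfolding k2_def using Hfacts(5)[of n] by simp
  have k2_lim: "(\<lambda>n. k2 n / real n) \<longlonglongrightarrow> c2"
  proof -
    define m where "m n = real (K n) * (real (K n) - 1) / (4 * (q n)\<^sup>2) * S 2 n" for n
    have "\<bar>k2 n - m n\<bar> \<le> E n" for n
    proof -
      have "norm (L'' n 0 - lead_cgf'' n (N n) (K n) (q n) 0) \<le> E n"
        unfolding L''_def E_def by (rule array_cgf''_approx[OF N Kp(2) q(1)]) (use q(1)[of n] in simp)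
      moreover have "lead_cgf'' n (N n) (K n) (q n) 0 = of_real (m n)"
        unfolding m_def S_def by (rule lead_cgf''_0[OF N q(1)])
      ultimately have "norm (complex_of_real (k2 n - m n)) \<le> E n" by (simp add: k2)
      then show ?thesis by (simp only: norm_of_real)
    qed
    then have "(\<lambda>n. k2 n / real n - m n / real n) \<longlonglongrightarrow> 0"
      by (intro Lim_null_comparison[OF _ E_lim] always_eventually allI)
        (simp add: divide_right_mono flip: diff_divide_distrib)
    \<comment> \<open>K is asymptotic to p s and q to p, so K (K - 1) / q^2 tends to s^2; the
      Riemann sum contributes 2 \<open>I2\<close>, which turns the prefactor 1/4 into 1/2.\<close>
    moreover have "(\<lambda>n. m n / real n) \<longlonglongrightarrow> c2"
    proof -
      have "(\<lambda>n. (real (K n) * (real (K n) - 1) / (q n)\<^sup>2) / 4 * (S 2 n / real n)) \<longlonglongrightarrow> s\<^sup>2 / 4 * (2 * I2)"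
        unfolding I2_def by (intro tendsto_mult tendsto_divide K_lim S tendsto_const) auto
      then show ?thesis by (simp add: m_def c2_def mult_ac)
    qed
    ultimately show ?thesis using tendsto_add[of "\<lambda>n. k2 n / real n - m n / real n" 0 _ "\<lambda>n. m n / real n" c2] by simp
  qed

  define D where "D n = deriv (L'' n) 0" for n
  \<comment> \<open>The scaling is balanced here: \<epsilon>^3 = p/n cancels both the n terms of the
    sum and the extra 1/q in the derivative of the leading sum. The same cancellation turns the
    error 8 E / q into at most 8 E / n.\<close>
  have D_lim: "(\<lambda>n. of_real (\<epsilon> n ^ 3) * D n) \<longlonglongrightarrow> of_real (- (s\<^sup>2 * I3))"
  proof -
    define m where "m n = - (real (K n) * (real (K n) - 1) / (2 * q n ^ 3)) * S 3 n" for n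
    have Dm: "norm (D n - of_real (m n)) \<le> 8 * E n / q n" for n
      unfolding D_def m_def S_def L''_def E_def by (rule array_deriv3_approx[OF N Kp(2) q(1)])
    have eps3: "\<forall>\<^sub>F n in sequentially. \<epsilon> n ^ 3 = real (p n) / real n"
      using eventually_gt_at_top[of 0] by eventually_elim (simp add: \<epsilon>_def frac_cbrt_bounds(1)[OF _ p_pos])
    have "(\<lambda>n. of_real (\<epsilon> n ^ 3) * D n - of_real (\<epsilon> n ^ 3 * m n)) \<longlonglongrightarrow> 0"
    proof (rule Lim_null_comparison)
      show "(\<lambda>n. 8 * (E n / real n)) \<longlonglongrightarrow> 0" using tendsto_mult_left[OF E_lim, of 8] by simp
      show "\<forall>\<^sub>F n in sequentially. norm (of_real (\<epsilon> n ^ 3) * D n - of_real (\<epsilon> n ^ 3 * m n)) \<le> 8 * (E n / real n)"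
        using eps3 eventually_gt_at_top[of 0]
      proof eventually_elim
        case (elim n)
        have "of_real (\<epsilon> n ^ 3) * D n - of_real (\<epsilon> n ^ 3 * m n) = of_real (real (p n) / real n) * (D n - of_real (m n))"
          unfolding elim(1) by (simp only: of_real_mult right_diff_distrib)
        then have "norm (of_real (\<epsilon> n ^ 3) * D n - of_real (\<epsilon> n ^ 3 * m n)) = real (p n) / real n * norm (D n - of_real (m n))"
          by (simp only: norm_mult norm_of_real) simp
        also have "\<dots> \<le> q n / real n * (8 * E n / q n)"
          using Dm[of n] by (intro mult_mono divide_right_mono) (auto simp: q_def)
        also have "\<dots> = 8 * (E n / real n)" using q(1)[of n] by simp
        finally show ?case .
      qed
    qed
    moreover have "(\<lambda>n. complex_of_real (\<epsilon> n ^ 3 * m n)) \<longlonglongrightarrow> of_real (- (s\<^sup>2 * I3))"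
    proof (rule tendsto_of_real)
      have "(\<lambda>n. - ((real (K n) * (real (K n) - 1) / (q n)\<^sup>2) / 2) * (S 3 n / real n) * (1 / (q n / real (p n)))) \<longlonglongrightarrow> - (s\<^sup>2 / 2) * (2 * I3) * (1 / 1)"
        unfolding I3_def by (intro tendsto_mult tendsto_divide tendsto_minus K_lim S tendsto_const qp) auto
      moreover have "\<forall>\<^sub>F n in sequentially. - ((real (K n) * (real (K n) - 1) / (q n)\<^sup>2) / 2) * (S 3 n / real n) * (1 / (q n / real (p n))) = \<epsilon> n ^ 3 * m n"
        using eps3
      proof eventually_elim
        case (elim n)
        show ?case unfolding elim m_def by (simp add: power2_eq_square power3_eq_cube mult_ac)
      qed
      ultimately show "(\<lambda>n. \<epsilon> n ^ 3 * m n) \<longlonglongrightarrow> - (s\<^sup>2 * I3)"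
        by (simp add: Lim_transform_eventually)
    qed
    ultimately show ?thesis using tendsto_add[of "\<lambda>n. of_real (\<epsilon> n ^ 3) * D n - of_real (\<epsilon> n ^ 3 * m n)" 0] by fastforce
  qed

  \<comment> \<open>Convergence of the logarithm of the normalised moment generating
    function\<close>
  have eps_small: "\<forall>\<^sub>F n in sequentially. n > 0 \<and> \<epsilon> n * B < q n / 8" if B: "B \<ge> 0" for B
  proof -
    have "(\<lambda>n. real n powr (-1/3) * (B + 1)) \<longlonglongrightarrow> 0" by real_asymp
    then have "\<forall>\<^sub>F n in sequentially. real n powr (-1/3) * (B + 1) < 1 / 8"
      by (rule order_tendstoD) simp
    then show ?thesis using eventually_gt_at_top[of 0]
    proof eventually_elim
      case (elim n)
      have "\<epsilon> n / q n * B \<le> real n powr (-1/3) * (B + 1)"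
        using frac_cbrt_bounds(3)[OF elim(2) p_pos, of n] B by (intro mult_mono) (auto simp: \<epsilon>_def q_def)
      then have "\<epsilon> n / q n * B < 1 / 8" using elim by linarith
      then show ?case using elim q(1)[of n] by (simp add: field_simps)
    qed
  qed
  have \<tau>: "\<tau> n = (\<epsilon> n)\<^sup>2 * k2 n" if "n > 0" for n
    using frac_cbrt_bounds(2)[OF that p_pos, of n] by (simp add: \<tau>_def k2_def \<epsilon>_def)

  \<comment> \<open>For large n, \<open>exp (rem n w)\<close> is the quantity whose limit is sought.
    Working with its logarithm lets the linear and quadratic Taylor terms cancel before any estimate
    is made.\<close>
  define rem where "rem n w = L n (of_real (\<epsilon> n) * w) - of_real (\<epsilon> n) * w * L' n 0 - of_real (\<tau> n) * w\<^sup>2 / 2" for n w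
  have mgf_X: "mgf (M n) (X n) w = exp (L n (of_real (\<epsilon> n) * w) - of_real (\<epsilon> n) * w * L' n 0)"
    if "norm (of_real (\<epsilon> n) * w) < q n / 4" for n w
  proof -
    have "mgf (M n) (X n) w = (\<integral>\<omega>. exp (- (of_real (\<epsilon> n) * w * L' n 0)) * exp (of_real (\<epsilon> n) * w * of_real (H n \<omega>)) \<partial>M n)"
      unfolding mgf_def X_def Hfacts(4)[symmetric]
      by (intro Bochner_Integration.integral_cong refl) (simp add: algebra_simps flip: exp_add)
    also have "\<dots> = exp (- (of_real (\<epsilon> n) * w * L' n 0)) * mgf (M n) (H n) (of_real (\<epsilon> n) * w)"
      unfolding mgf_def by (rule integral_mult_right_zero)
    also have "mgf (M n) (H n) (of_real (\<epsilon> n) * w) = exp (L n (of_real (\<epsilon> n) * w))"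
      by (rule Hfacts(3)[OF that])
    finally show ?thesis by (simp add: exp_diff exp_minus field_simps)
  qed
  \<comment> \<open>Defect of the third Taylor coefficient, before division by 3! = 6, relative to
    its limit.\<close>
  define c3 where "c3 n = of_real (\<epsilon> n ^ 3) * D n + of_real (s\<^sup>2 * I3)" for n
  have c3_lim: "c3 \<longlonglongrightarrow> 0"
    using tendsto_add[OF D_lim tendsto_const[of "of_real (s\<^sup>2 * I3)"]] by (simp add: c3_def[abs_def])
  have rem_bound: "norm (rem n w - (- (w ^ 3) * of_real (s\<^sup>2 / 6 * I3))) \<le> norm (c3 n) * B ^ 3 / 6 + 43776 * real n powr (-1/3) * B ^ 4"
    if n: "n > 0" "\<epsilon> n * B < q n / 8" and w: "norm w \<le> B" for n w B
  proof -
    define v where "v = of_real (\<epsilon> n) * w"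
    have \<epsilon>: "\<epsilon> n > 0" using frac_cbrt_bounds(5)[OF n(1) p_pos, of n] by (simp add: \<epsilon>_def)
    have nv: "norm v = \<epsilon> n * norm w" using \<epsilon> by (simp add: v_def norm_mult)
    also have "\<dots> \<le> \<epsilon> n * B" using \<epsilon> w by (intro mult_left_mono) auto
    \<comment> \<open>This is the condition |w| <= r/2 of \<open>Taylor3_bound\<close> with r = q/4,
      and the reason for the threshold q/8 in \<open>eps_small\<close>.\<close>
    finally have v: "norm v \<le> (q n / 4) / 2" using n(2) by simp
    have "norm (L n v - (L n 0 + L' n 0 * v + L'' n 0 * v\<^sup>2 / 2 + D n * v ^ 3 / 6)) \<le> 6 * (456 * real n) * norm v ^ 4 / (q n / 4)\<^sup>2"
      unfolding D_def L_def L'_def L''_def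
    proof (rule Taylor3_bound[OF _ _ _ _ v])
      fix u :: complex assume u: "u \<in> ball 0 (q n / 4)"
      show "norm (array_cgf'' n (N n) (K n) (q n) u) \<le> 456 * real n"
        by (rule norm_array_cgf''_le[OF N Kp(2) q(2)]) (use u in simp)
    qed (use q in \<open>auto intro!: has_field_derivative_array_cgf N Kp\<close>)
    \<comment> \<open>The constant is 6 * 456 * 16, the factor 16 coming from the squared radius
      (q/4)^2.\<close>
    also have "6 * (456 * real n) * norm v ^ 4 / (q n / 4)\<^sup>2 = 43776 * ((\<epsilon> n ^ 4 * real n / (q n)\<^sup>2) * norm w ^ 4)"
      unfolding nv by (simp add: power_mult_distrib power2_eq_square)
    also have "\<dots> \<le> 43776 * (real n powr (-1/3) * B ^ 4)"
      using frac_cbrt_bounds(4)[OF n(1) p_pos, of n] w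
      by (intro mult_left_mono mult_mono power_mono) (auto simp: \<epsilon>_def q_def)
    finally have 1: "norm (L n v - (L n 0 + L' n 0 * v + L'' n 0 * v\<^sup>2 / 2 + D n * v ^ 3 / 6)) \<le> 43776 * real n powr (-1/3) * B ^ 4"
      by simp
    \<comment> \<open>Here \<open>L n 0 = 0\<close>, the centring removes \<open>L' n 0\<close>, and
      \<open>L'' n 0\<close> times \<epsilon>^2 is exactly \<open>\<tau> n\<close>, so only the
      cubic defect and the remainder are left.\<close>
    have "rem n w - (- (w ^ 3) * of_real (s\<^sup>2 / 6 * I3)) =
       (L n v - (L n 0 + L' n 0 * v + L'' n 0 * v\<^sup>2 / 2 + D n * v ^ 3 / 6)) + c3 n * w ^ 3 / 6"
      unfolding rem_def k2 \<tau>[OF n(1)] v_def c3_def L_def by (simp add: algebra_simps power_mult_distrib)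
    then have "norm (rem n w - (- (w ^ 3) * of_real (s\<^sup>2 / 6 * I3))) \<le> 43776 * real n powr (-1/3) * B ^ 4 + norm (c3 n * w ^ 3 / 6)"
      using 1 norm_triangle_ineq[of "L n v - (L n 0 + L' n 0 * v + L'' n 0 * v\<^sup>2 / 2 + D n * v ^ 3 / 6)" "c3 n * w ^ 3 / 6"] by simp
    moreover have "norm (c3 n * w ^ 3 / 6) \<le> norm (c3 n) * B ^ 3 / 6"
      unfolding norm_divide norm_mult norm_power using w by (simp add: mult_left_mono power_mono)
    ultimately show ?thesis by simp
  qed
  have rem_lim: "uniform_limit (cball 0 B) rem (\<lambda>w. - (w ^ 3) * of_real (s\<^sup>2 / 6 * I3)) sequentially" if B: "B \<ge> 0" for B
  proof (rule uniform_limitI)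
    fix e :: real assume e: "e > 0"
    have "(\<lambda>n. real n powr (-1/3)) \<longlonglongrightarrow> 0" by real_asymp
    then have "(\<lambda>n. norm (c3 n) * B ^ 3 / 6 + 43776 * real n powr (-1/3) * B ^ 4) \<longlonglongrightarrow> norm (0::complex) * B ^ 3 / 6 + 43776 * 0 * B ^ 4"
      by (intro tendsto_intros c3_lim) auto
    then have "\<forall>\<^sub>F n in sequentially. norm (c3 n) * B ^ 3 / 6 + 43776 * real n powr (-1/3) * B ^ 4 < e"
      by (rule order_tendstoD(2)) (use e in simp)
    then show "\<forall>\<^sub>F n in sequentially. \<forall>w\<in>cball 0 B. dist (rem n w) (- (w ^ 3) * of_real (s\<^sup>2 / 6 * I3)) < e"
      using eps_small[OF B]
    proof eventually_elim
      case (elim n)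
      then show ?case unfolding dist_norm using rem_bound[of n B] by fastforce
    qed
  qed
  have exp_lim: "uniform_limit (cball 0 B) (\<lambda>n w. exp (- complex_of_real (\<tau> n) * (w\<^sup>2 / 2)) * mgf (M n) (X n) w) \<psi> sequentially"
    if B: "B \<ge> 0" for B
  proof -
    \<comment> \<open>On the whole plane \<open>exp\<close> is not uniformly continuous. All values
      of \<open>rem\<close> lie eventually in this compact ball: the limit is bounded on
      \<open>cball 0 B\<close>, and 1 is added for the distance to it.\<close>
    define Q where "Q = B ^ 3 * \<bar>s\<^sup>2 / 6 * I3\<bar> + 1"
    have "uniform_limit (cball 0 B) (\<lambda>n w. exp (rem n w)) (\<lambda>w. exp (- (w ^ 3) * of_real (s\<^sup>2 / 6 * I3))) sequentially"
    proof (rule uniform_limit_compose_uniformly_continuous_on[OF rem_lim[OF B]])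
      show "uniformly_continuous_on (cball 0 Q) (exp :: complex \<Rightarrow> complex)"
        by (intro compact_uniformly_continuous continuous_intros) auto
      show "\<forall>\<^sub>F n in sequentially. \<forall>w\<in>cball 0 B. rem n w \<in> cball 0 Q"
        using uniform_limitD[OF rem_lim[OF B] zero_less_one]
      proof (rule eventually_mono, intro ballI)
        fix n and w :: complex assume a: "\<forall>w\<in>cball 0 B. dist (rem n w) (- (w ^ 3) * of_real (s\<^sup>2 / 6 * I3)) < 1" and w: "w \<in> cball 0 B"
        have "norm (- (w ^ 3) * complex_of_real (s\<^sup>2 / 6 * I3)) \<le> B ^ 3 * \<bar>s\<^sup>2 / 6 * I3\<bar>"
          unfolding norm_mult norm_minus_cancel norm_power norm_of_real using w by (intro mult_right_mono power_mono) auto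
        moreover have "norm (rem n w - (- (w ^ 3) * of_real (s\<^sup>2 / 6 * I3))) < 1"
          using a w by (metis dist_norm)
        ultimately show "rem n w \<in> cball 0 Q"
          using norm_triangle_sub[of "rem n w" "- (w ^ 3) * of_real (s\<^sup>2 / 6 * I3)"] by (simp add: Q_def)
      qed
    qed auto
    moreover have "\<forall>\<^sub>F n in sequentially. \<forall>w\<in>cball 0 B. exp (rem n w) = exp (- complex_of_real (\<tau> n) * (w\<^sup>2 / 2)) * mgf (M n) (X n) w"
      using eps_small[OF B]
    proof (rule eventually_mono, intro ballI)
      fix n and w :: complex assume n: "n > 0 \<and> \<epsilon> n * B < q n / 8" and w: "w \<in> cball 0 B"
      have "\<epsilon> n \<ge> 0" by (simp add: \<epsilon>_def)
      then have "\<epsilon> n * norm w \<le> \<epsilon> n * B" using w by (intro mult_left_mono) auto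
      then have "norm (of_real (\<epsilon> n) * w) < q n / 4" using n \<open>\<epsilon> n \<ge> 0\<close> q(1)[of n] by (simp add: norm_mult)
      then show "exp (rem n w) = exp (- complex_of_real (\<tau> n) * (w\<^sup>2 / 2)) * mgf (M n) (X n) w"
        by (simp add: mgf_X rem_def algebra_simps flip: exp_add)
    qed
    ultimately show ?thesis unfolding \<psi>_def
      by (subst (asm) uniform_limit_cong) auto
  qed

  \<comment> \<open>Growth of the speed\<close>
  have g_lim: "filterlim g at_top sequentially"
  proof (rule filterlim_at_top_mono)
    show "filterlim (\<lambda>n. real n powr (1/3) * c2) at_top sequentially"
      using c2 by real_asymp
    show "\<forall>\<^sub>F n in sequentially. real n powr (1/3) * c2 \<le> g n"
    proof (intro always_eventually allI)
      fix n
      have "1 \<le> real (p n) powr (2/3)" using p_pos[of n] by (intro ge_one_powr_ge_zero) auto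
      then have "real n powr (1/3) * 1 * c2 \<le> real n powr (1/3) * real (p n) powr (2/3) * c2"
        using c2 by (intro mult_right_mono mult_left_mono) auto
      then show "real n powr (1/3) * c2 \<le> g n" by (simp add: g_def c2_def mult_ac)
    qed
  qed
  have \<tau>_g: "\<tau> \<sim>[sequentially] g"
  proof (rule asymp_equivI')
    \<comment> \<open>The powers of p cancel and those of n recombine to n, so
      \<open>\<tau> n / g n\<close> is just the normalised variance divided by its limit.\<close>
    have "(\<lambda>n. (k2 n / real n) / c2) \<longlonglongrightarrow> c2 / c2"
      using c2 by (intro tendsto_divide k2_lim tendsto_const) auto
    moreover have "\<forall>\<^sub>F n in sequentially. (k2 n / real n) / c2 = \<tau> n / g n"
      using eventually_gt_at_top[of 0]
    proof eventually_elim
      case (elim n)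
      have "real n powr (2/3) * real n powr (1/3) = real n" using elim by (simp flip: powr_add)
      then have nn: "real n powr (1/3) * real n powr (2/3) = real n" by (simp add: mult.commute)
      have "\<tau> n / g n = (real (p n) powr (2/3) / real n powr (2/3) * k2 n) / (real n powr (1/3) * real (p n) powr (2/3) * c2)"
        using elim by (simp add: \<tau>_def g_def c2_def k2_def powr_divide mult_ac)
      also have "\<dots> = k2 n / (real n powr (1/3) * real n powr (2/3) * c2)"
        using p_pos[of n] by (simp add: field_simps)
      finally show ?case unfolding nn by simp
    qed
    ultimately show "(\<lambda>n. \<tau> n / g n) \<longlonglongrightarrow> 1"
      using c2 by (simp add: Lim_transform_eventually)
  qed
  have \<tau>_lim: "filterlim \<tau> at_top sequentially"
    using asymp_equiv_at_top_transfer[OF asymp_equiv_symI[OF \<tau>_g] g_lim] .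

  \<comment> \<open>Convergence on a given strip\<close>
  have conv: "\<exists>n0. mod_gaussian_convergent a b (\<lambda>n. M (n + n0)) (\<lambda>n. X (n + n0)) (\<lambda>n. \<tau> (n + n0)) \<psi>" if "a < b" for a b
  proof -
    \<comment> \<open>Existence of the moment generating function depends on Re z alone, which this
      \<open>B\<close> bounds on the strip; \<open>n0\<close> therefore depends only on
      \<open>a\<close> and \<open>b\<close> although the strip is unbounded.\<close>
    define B where "B = max \<bar>a\<bar> \<bar>b\<bar>"
    have B: "B \<ge> 0" by (simp add: B_def)
    obtain n0 where n0: "\<And>n. n \<ge> n0 \<Longrightarrow> n > 0 \<and> \<epsilon> n * B < q n / 8"
      using eps_small[OF B] by (auto simp: eventually_sequentially)
    have "mod_phi_convergent std_normal_distribution (\<lambda>z. z\<^sup>2 / 2) a b (\<lambda>n. M (n + n0)) (\<lambda>n. X (n + n0)) (\<lambda>n. \<tau> (n + n0)) \<psi>"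
      unfolding mod_phi_convergent_def
    proof (intro conjI allI ballI)
      show "infinitely_divisible std_normal_distribution" by (rule infinitely_divisible_std_normal)
      show "\<nexists>c. std_normal_distribution = return borel c" using std_normal_distribution_neq_return by blast
      show "mgf_exists_on std_normal_distribution (\<lambda>x. x) (strip a b)"
        by (simp add: mgf_exists_on_def integrable_exp_std_normal)
      show "mgf std_normal_distribution (\<lambda>x. x) z = exp (z\<^sup>2 / 2)" for z by (rule mgf_std_normal)
      show "prob_space (M (n + n0))" for n using array by (simp add: beta_array_def)
      show X_meas: "X (n + n0) \<in> borel_measurable (M (n + n0))" for n
        unfolding X_def using Hfacts(1)[of "n + n0"] by measurable
      show "mgf_exists_on (M (n + n0)) (X (n + n0)) (strip a b)" for n
        unfolding mgf_exists_on_def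
      proof
        fix z assume z: "z \<in> strip a b"
        define m where "m = n + n0"
        have m: "\<epsilon> m * B < q m / 8" using n0[of m] by (simp add: m_def)
        have e0: "\<epsilon> m \<ge> 0" by (simp add: \<epsilon>_def)
        have "\<bar>\<epsilon> m * Re z\<bar> \<le> \<epsilon> m * B"
          using z e0 by (auto simp: abs_mult strip_def B_def intro!: mult_left_mono)
        then have "integrable (M m) (\<lambda>\<omega>. exp (- (\<epsilon> m * Re z * integral\<^sup>L (M m) (H m))) * exp (\<epsilon> m * Re z * H m \<omega>))"
          using m q(1)[of m] by (intro integrable_mult_right Hfacts(2)) auto
        then show "integrable (M (n + n0)) (\<lambda>\<omega>. exp (z * complex_of_real (X (n + n0) \<omega>)))"
          unfolding m_def[symmetric]
        proof (rule Bochner_Integration.integrable_bound)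
          show "(\<lambda>\<omega>. exp (z * complex_of_real (X m \<omega>))) \<in> borel_measurable (M m)"
            using X_meas[of n] unfolding m_def by measurable
          show "AE \<omega> in M m. norm (exp (z * complex_of_real (X m \<omega>))) \<le>
             norm (exp (- (\<epsilon> m * Re z * integral\<^sup>L (M m) (H m))) * exp (\<epsilon> m * Re z * H m \<omega>))"
            by (intro AE_I2) (simp add: X_def algebra_simps flip: exp_add)
        qed
      qed
      show "filterlim (\<lambda>n. \<tau> (n + n0)) at_top sequentially"
        by (rule filterlim_compose[OF \<tau>_lim filterlim_add_const_nat_at_top])
      show "\<psi> analytic_on strip a b" unfolding \<psi>_def by (intro analytic_intros)
      show "\<psi> z \<noteq> 0" for z by (simp add: \<psi>_def)
      fix z assume z: "z \<in> strip a b"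
      \<comment> \<open>Half the distance to the boundary, so that even the closed ball stays inside
        the open strip.\<close>
      define d where "d = min (Re z - a) (b - Re z) / 2"
      have d: "d > 0" using z by (simp add: d_def strip_def)
      have sub: "cball z d \<subseteq> strip a b"
      proof
        fix w assume "w \<in> cball z d"
        then have "\<bar>Re (z - w)\<bar> \<le> d" using abs_Re_le_cmod[of "z - w"] by (simp add: dist_norm)
        moreover have "d < Re z - a" "d < b - Re z" using z by (auto simp: d_def strip_def min_def)
        ultimately show "w \<in> strip a b" by (auto simp: strip_def abs_le_iff)
      qed
      have sub0: "cball z d \<subseteq> cball 0 (norm z + d)"
      proof
        fix w assume "w \<in> cball z d"
        then show "w \<in> cball 0 (norm z + d)"
          using norm_triangle_sub[of w z] by (simp add: dist_norm norm_minus_commute)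
      qed
      \<comment> \<open>\<open>exp_lim\<close> is used with radius \<open>norm z + d\<close> and not
        with \<open>B\<close>, as imaginary parts are not bounded on the strip; the limit is only
        locally uniform.\<close>
      have "uniform_limit (cball z d) (\<lambda>n w. exp (- complex_of_real (\<tau> n) * (w\<^sup>2 / 2)) * mgf (M n) (X n) w) \<psi> sequentially"
        by (rule uniform_limit_on_subset[OF exp_lim sub0]) (use d in auto)
      then have "uniform_limit (cball z d) (\<lambda>n w. exp (- complex_of_real (\<tau> (n + n0)) * (w\<^sup>2 / 2)) * mgf (M (n + n0)) (X (n + n0)) w) \<psi> sequentially"
        by (rule filterlim_compose[OF _ filterlim_add_const_nat_at_top])
      then show "\<exists>d>0. cball z d \<subseteq> strip a b \<and>
          uniform_limit (cball z d) (\<lambda>n w. exp (- complex_of_real (\<tau> (n + n0)) * (w\<^sup>2 / 2)) * mgf (M (n + n0)) (X (n + n0)) w) \<psi> sequentially"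
        using d sub by blast
    qed
    then show ?thesis unfolding mod_gaussian_convergent_def by blast
  qed
  show ?thesis
    unfolding Let_def
    using conv \<tau>_g \<tau>_lim g_lim
    unfolding X_def \<tau>_def g_def \<psi>_def I2_def I3_def H_def \<epsilon>_def by blast
qed

end
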